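(* Let $k>1$ be an integer and let $D>0$ be a non-square discriminant. Then the function $\mathcal{F}_{1-k,D}$ is a weight $2-2k$ locally harmonic Maass form for $\Gamma_1=\mathrm{SL}_2(\mathbb{Z})$ with exceptional set $E_D$.
   Context: Write $\tau=x+iy\in\mathbb{H}$ with $y>0$. A discriminant is an integer $\equiv 0,1 \pmod 4$. $\mathcal{Q}_D$ is the set of integral binary quadratic forms $Q=[a,b,c]$, $Q(X,Y)=aX^2+bXY+cY^2$, $a,b,c\in\mathbb{Z}$, $b^2-4ac=D$. For $0\le v\le 1$ let $\psi(v):=\frac12\int_0^v u^{k-\frac32}(1-u)^{-\frac12}\,du$ (a special value of the incomplete beta function $\beta(v;k-\frac12,\frac12)$). Define $$\mathcal{F}_{1-k,D}(\tau):=\frac{D^{\frac12-k}}{\binom{2k-2}{k-1}\pi}\sum_{Q=[a,b,c]\in\mathcal{Q}_D}\operatorname{sgn}\left(a|\tau|^2+bx+c\right)Q(\tau,1)^{k-1}\psi\left(\frac{Dy^2}{|Q(\tau,1)|^2}\right),$$ with $\operatorname{sgn}(0)=0$. For $Q=[a,b,c]$ let $S_Q:=\{\tau\in\mathbb{H}: a|\tau|^2+bx+c=0\}$, and $E_D:=\bigcup_{Q\in\mathcal{Q}_D}S_Q$. For $\gamma=\begin{pmatrix}a&b\\c&d\end{pmatrix}\in\Gamma_1$ and $w\in 2\mathbb{Z}$, $(F|_w\gamma)(\tau):=(c\tau+d)^{-w}F(\gamma\tau)$. The weight $2-2k$ hyperbolic Laplacian is $\Delta_{2-2k}:=-y^2\left(\frac{\partial^2}{\partial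 x^2}+\frac{\partial^2}{\partial y^2}\right)+i(2-2k)y\left(\frac{\partial}{\partial x}+i\frac{\partial}{\partial y}\right)$. A weight $2-2k$ locally harmonic Maass form for $\Gamma_1$ with exceptional set $E_D$ is a function $F:\mathbb{H}\to\mathbb{C}$ such that: (1) $F|_{2-2k}\gamma=F$ for all $\gamma\in\Gamma_1$; (2) every $\tau\in\mathbb{H}\setminus E_D$ has a neighborhood on which $F$ is real analytic and $\Delta_{2-2k}(F)=0$; (3) for $\tau\in E_D$, $F(\tau)=\frac12\lim_{w\to0^+}(F(\tau+iw)+F(\tau-iw))$ ($w$ real); (4) $F$ has at most polynomial growth towards $i\infty$. *)

theory Defs
  imports "HOL-Analysis.Analysis"
begin

definition upper_half_plane :: "complex set" where
  "upper_half_plane = {\<tau>. Im \<tau> > 0}"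

definition discriminant :: "int \<Rightarrow> bool" where
  "discriminant D \<longleftrightarrow> D mod 4 = 0 \<or> D mod 4 = 1"

text \<open>The triple \<open>(a, b, c)\<close> stands for the form \<open>[a, b, c] = a X^2 + b X Y + c Y^2\<close>.\<close>

type_synonym qform = "int \<times> int \<times> int"

definition qforms :: "int \<Rightarrow> qform set" where
  "qforms D = {(a, b, c). b\<^sup>2 - 4 * a * c = D}"

fun qform_eval :: "qform \<Rightarrow> complex \<Rightarrow> complex \<Rightarrow> complex" where
  "qform_eval (a, b, c) X Y = of_int a * X\<^sup>2 + of_int b * X * Y + of_int c * Y\<^sup>2"

fun qform_circle :: "qform \<Rightarrow> complex \<Rightarrow> real" where
  "qform_circle (a, b, c) \<tau> = of_int a * (cmod \<tau>)\<^sup>2 + of_int b * Re \<tau> + of_int c"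

definition geodesic :: "qform \<Rightarrow> complex set" where
  "geodesic Q = {\<tau> \<in> upper_half_plane. qform_circle Q \<tau> = 0}"

definition exceptional_set :: "int \<Rightarrow> complex set" where
  "exceptional_set D = (\<Union>Q\<in>qforms D. geodesic Q)"

text \<open>The integral is improper at \<open>u = 1\<close> when \<open>v = 1\<close>; the Henstock-Kurzweil integral over the
  closed interval covers this case directly, the value of the integrand at \<open>1\<close> being irrelevant.\<close>

definition psi :: "nat \<Rightarrow> real \<Rightarrow> real" where
  "psi k v = 1/2 * integral {0..v} (\<lambda>u. u powr (real k - 3/2) * (1 - u) powr (-1/2))"

definition F_summand :: "nat \<Rightarrow> int \<Rightarrow> complex \<Rightarrow> qform \<Rightarrow> complex" where
  "F_summand k D \<tau> Q =
     of_real (sgn (qform_circle Q \<tau>)) * qform_eval Q \<tau> 1 ^ (k - 1) *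
     of_real (psi k (of_int D * (Im \<tau>)\<^sup>2 / (cmod (qform_eval Q \<tau> 1))\<^sup>2))"

definition F_fun :: "nat \<Rightarrow> int \<Rightarrow> complex \<Rightarrow> complex" where
  "F_fun k D \<tau> =
     of_real (of_int D powr (1/2 - real k) / (real ((2 * k - 2) choose (k - 1)) * pi)) *
     (\<Sum>\<^sub>\<infinity>Q\<in>qforms D. F_summand k D \<tau> Q)"

definition SL2Z :: "(int^2^2) set" where
  "SL2Z = {\<gamma>. det \<gamma> = 1}"

definition moebius :: "int^2^2 \<Rightarrow> complex \<Rightarrow> complex" where
  "moebius \<gamma> \<tau> =
     (of_int (\<gamma>$1$1) * \<tau> + of_int (\<gamma>$1$2)) / (of_int (\<gamma>$2$1) * \<tau> + of_int (\<gamma>$2$2))"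

definition slash :: "(complex \<Rightarrow> complex) \<Rightarrow> int \<Rightarrow> int^2^2 \<Rightarrow> complex \<Rightarrow> complex" where
  "slash F w \<gamma> \<tau> =
     (of_int (\<gamma>$2$1) * \<tau> + of_int (\<gamma>$2$2)) powi (- w) * F (moebius \<gamma> \<tau>)"

text \<open>Real analyticity in the two real variables \<open>x = Re z\<close> and \<open>y = Im z\<close>: near every point of
  the set, the function is the sum of an (unconditionally convergent) double power series.\<close>

definition real_analytic_on :: "(complex \<Rightarrow> complex) \<Rightarrow> complex set \<Rightarrow> bool" where
  "real_analytic_on F U \<longleftrightarrow>
     (\<forall>z\<in>U. \<exists>r>0. \<exists>c :: nat \<times> nat \<Rightarrow> complex. \<forall>s t :: real. \<bar>s\<bar> < r \<longrightarrow> \<bar>t\<bar> < r \<longrightarrow>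
        ((\<lambda>(m, n). c (m, n) * of_real (s ^ m * t ^ n)) has_sum F (z + Complex s t)) UNIV)"

definition partial_x :: "(complex \<Rightarrow> complex) \<Rightarrow> complex \<Rightarrow> complex" where
  "partial_x F z = vector_derivative (\<lambda>t::real. F (z + of_real t)) (at 0)"

definition partial_y :: "(complex \<Rightarrow> complex) \<Rightarrow> complex \<Rightarrow> complex" where
  "partial_y F z = vector_derivative (\<lambda>t::real. F (z + \<i> * of_real t)) (at 0)"

definition hyperbolic_laplacian ::
  "int \<Rightarrow> (complex \<Rightarrow> complex) \<Rightarrow> complex \<Rightarrow> complex" where
  "hyperbolic_laplacian w F z =
     - of_real ((Im z)\<^sup>2) * (partial_x (partial_x F) z + partial_y (partial_y F) z)
     + \<i> * of_int w * of_real (Im z) * (partial_x F z + \<i> * partial_y F z)"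

text \<open>Functions on the upper half-plane are represented by functions on \<open>complex\<close> whose values
  outside the upper half-plane are irrelevant. The growth bound is uniform in \<open>Re \<tau>\<close>.\<close>

definition locally_harmonic_maass_form ::
  "int \<Rightarrow> complex set \<Rightarrow> (complex \<Rightarrow> complex) \<Rightarrow> bool" where
  "locally_harmonic_maass_form w E F \<longleftrightarrow>
     (\<forall>\<gamma>\<in>SL2Z. \<forall>\<tau>\<in>upper_half_plane. slash F w \<gamma> \<tau> = F \<tau>) \<and>
     (\<forall>\<tau>\<in>upper_half_plane - E. \<exists>U. open U \<and> \<tau> \<in> U \<and> U \<subseteq> upper_half_plane \<and>
        real_analytic_on F U \<and> (\<forall>z\<in>U. hyperbolic_laplacian w F z = 0)) \<and>
     (\<forall>\<tau>\<in>E. \<exists>L. ((\<lambda>h::real. F (\<tau> + \<i> * of_real h) + F (\<tau> - \<i> * of_real h)) \<longlongrightarrow> L) (at_right 0) \<and>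
        F \<tau> = 1/2 * L) \<and>
     (\<exists>(N::nat) C Y. Y > 0 \<and> (\<forall>\<tau>. Im \<tau> \<ge> Y \<longrightarrow> cmod (F \<tau>) \<le> C * Im \<tau> ^ N))"

end

theory Submission
  imports Defs "HOL-Complex_Analysis.Complex_Analysis"
begin

text \<open>
  With \<open>q = a|\<tau>|\<^sup>2 + bx + c\<close> one has \<open>|Q(\<tau>,1)|\<^sup>2 = D y\<^sup>2 + q\<^sup>2\<close>, which controls the coefficient \<open>b\<close> linearly by
  \<open>|Q(\<tau>,1)|\<close>. Since \<open>D\<close> is not a square, \<open>b\<close> leaves only divisor-many choices of \<open>a\<close>, and the bound
  \<open>d(n) = O(n\<^bsup>1/3\<^esup>)\<close> makes the series and its local majorants converge. Modularity is the reindexing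
  \<open>Q \<mapsto> Q \<circ> \<gamma>\<close>, and the value on a geodesic is obtained by passing to the limit termwise.

  For harmonicity, \<open>\<psi>(D/(D+t\<^sup>2))\<close> has the rational \<open>t\<close>-derivative \<open>\<mp> D\<^bsup>k-1/2\<^esup> (D+t\<^sup>2)\<^bsup>-k\<^esup>\<close>, so with \<open>t = q/y\<close> the
  \<open>\<partial>/\<partial>\<tau>\<^sup>*\<close>-derivative of each term (\<open>\<tau>\<^sup>*\<close> being the conjugate of \<open>\<tau>\<close>) is a constant times \<open>y\<^bsup>2k-2\<^esup>\<close> times
  the conjugate of \<open>Q(\<tau>,1)\<^bsup>-k\<^esup>\<close>. Subtracting the corresponding Eichler integral, a polynomial in \<open>\<tau>\<close> whose
  coefficients are antiholomorphic primitives, leaves a holomorphic function. Off the geodesics, both parts can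
  be summed over \<open>Q\<close>.
\<close>

section \<open>Divisor bounds and a summable weight on forms\<close>

text \<open>The tight case is k = 2, where the available majorant of a term decays only like
  (1+|b|)^(-2). The elementary bound d(n) = O(n^(1/2)) would leave the divergent series of 1/|b|, so
  a divisor exponent below 1/2 is required. The value 1/3 leaves |b|^(-4/3), and cubing the divisor
  count keeps the estimate within the natural numbers. Differentiating the series twice is not an
  option: the estimates control the terms and not their derivatives, and locally uniform limits need
  not preserve real analyticity. For holomorphic terms both properties do pass to the limit. Once
  the kernel of the Eichler integral is expanded, every infinite sum is a sum of holomorphic
  functions or of their conjugates, and what mixes tau with its conjugate is a finite sum of
  products.\<close>

lemma divisors_coprime_mult:
  fixes m n :: nat
  assumes "coprime m n" "m > 0" "n > 0"
  shows "card {d. d dvd m * n} \<le> card {d. d dvd m} * card {d. d dvd n}"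
proof -
  have "{d. d dvd m * n} \<subseteq> (\<lambda>(a, b). a * b) ` ({d. d dvd m} \<times> {d. d dvd n})"
    by (auto elim!: dvd_productE)
  moreover have fin: "finite ({d. d dvd m} \<times> {d. d dvd n})" using assms by simp
  ultimately have "card {d. d dvd m * n} \<le> card ((\<lambda>(a, b). a * b) ` ({d. d dvd m} \<times> {d. d dvd n}))"
    by (intro card_mono) auto
  also have "\<dots> \<le> card ({d. d dvd m} \<times> {d. d dvd n})" by (rule card_image_le[OF fin])
  finally show ?thesis by (simp add: card_cartesian_product)
qed

lemma card_divisors_prime_power:
  fixes p :: nat assumes "prime p"
  shows "card {d. d dvd p ^ e} = Suc e"
proof -
  have "{d. d dvd p ^ e} = (\<lambda>i. p ^ i) ` {..e}"
    by (auto simp: divides_primepow_nat[OF assms])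
  moreover have "inj_on (\<lambda>i. p ^ i) {..e}"
    using prime_gt_1_nat[OF assms] by (auto simp: inj_on_def)
  ultimately show ?thesis by (simp add: card_image)
qed

text \<open>The factor 8 is sharp, with equality at \<open>e = 3\<close>. From there on, raising
  \<open>e\<close> by one multiplies the left side by at most (5/4)^3 < 2, which drives the
  induction; the exponents up to 3 are checked directly.\<close>

lemma Suc_cubed_le_8_2_power: "Suc e ^ 3 \<le> 8 * 2 ^ e"
proof (induction e rule: less_induct)
  case (less e)
  show ?case
  proof (cases "e < 4")
    case True
    then have "e \<in> {0, 1, 2, 3}" by auto
    then show ?thesis by (auto simp: numeral_eq_Suc)
  next
    case False
    then obtain f where f: "e = f + 4" by (metis add.commute le_Suc_ex not_less)
    have IH: "Suc (f + 3) ^ 3 \<le> 8 * 2 ^ (f + 3)" using less.IH[of "f + 3"] f by auto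
    have "Suc e ^ 3 \<le> 2 * Suc (f + 3) ^ 3" unfolding f by (simp add: power3_eq_cube algebra_simps)
    also have "\<dots> \<le> 2 * (8 * 2 ^ (f + 3))" using IH by simp
    also have "\<dots> = 8 * 2 ^ e" by (simp add: f power_add)
    finally show ?thesis .
  qed
qed

text \<open>For a prime p above 8 this yields (e+1)^3 <= p^e with no constant lost. It is the cube
  of e+1 <= 2^e.\<close>

lemma Suc_cubed_le_power_8: "Suc e ^ 3 \<le> 8 ^ e"
proof -
  have "Suc e \<le> 2 ^ e" by (induction e) auto
  then have "Suc e ^ 3 \<le> (2 ^ e) ^ 3" by (rule power_mono) simp_all
  also have "((2::nat) ^ e) ^ 3 = (2 ^ 3) ^ e" by (simp only: power_mult [symmetric] mult.commute)
  finally show ?thesis by simp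
qed

text \<open>Only the primes below \<open>8 = 2 ^ 3\<close> cost a factor \<open>8\<close>.\<close>

lemma card_divisors_cubed_aux:
  fixes n :: nat
  assumes "n > 0"
  shows "card {d. d dvd n} ^ 3 \<le> 8 ^ card {p. prime p \<and> p dvd n \<and> p < 8} * n"
  using assms
proof (induction n rule: less_induct)
  case (less n)
  show ?case
  proof (cases "n = 1")
    case True
    then show ?thesis by simp
  next
    case False
    then obtain p where p: "prime p" "p dvd n" using prime_factor_nat by blast
    define e where "e = multiplicity p n"
    obtain m where m: "n = p ^ e * m" "\<not> p dvd m"
      using multiplicity_decompose'[of n p] p less.prems e_def by (metis not_prime_unit not_gr_zero)
    have e: "e > 0" using m p by (metis gr0I mult_1 power_0)
    have m0: "m > 0" using m less.prems by (cases m) auto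
    have "1 < p ^ e" using e prime_gt_1_nat[OF p(1)] by (intro one_less_power)
    then have "m < n" using m m0 by simp
    note IH = less.IH[OF this m0]
    define A where "A n = {p :: nat. prime p \<and> p dvd n \<and> p < 8}" for n
    have fin: "finite (A i)" for i unfolding A_def by (rule finite_subset[of _ "{..<8}"]) auto
    have cop: "coprime (p ^ e) m" using p m by (simp add: prime_imp_coprime)
    have "card {d. d dvd n} \<le> Suc e * card {d. d dvd m}"
      using divisors_coprime_mult[OF cop] m m0 p card_divisors_prime_power[OF p(1)] prime_gt_0_nat by simp
    then have "card {d. d dvd n} ^ 3 \<le> (Suc e * card {d. d dvd m}) ^ 3" by (rule power_mono) simp
    also have "\<dots> = Suc e ^ 3 * card {d. d dvd m} ^ 3" by (rule power_mult_distrib)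
    also have "\<dots> \<le> Suc e ^ 3 * (8 ^ card (A m) * m)" using IH by (simp add: A_def)
    also have "\<dots> \<le> 8 ^ card (A n) * n"
    proof (cases "p < 8")
      case True
      have "insert p (A m) \<subseteq> A n" using p m True by (auto simp: A_def)
      then have "card (insert p (A m)) \<le> card (A n)" by (intro card_mono fin)
      moreover have "p \<notin> A m" using m by (auto simp: A_def)
      ultimately have c: "Suc (card (A m)) \<le> card (A n)" using fin by simp
      have "Suc e ^ 3 \<le> 8 * 2 ^ e" by (rule Suc_cubed_le_8_2_power)
      also have "\<dots> \<le> 8 * p ^ e" using prime_ge_2_nat[OF p(1)] by (simp add: power_mono)
      finally have "Suc e ^ 3 * (8 ^ card (A m) * m) \<le> (8 * p ^ e) * (8 ^ card (A m) * m)" by (rule mult_right_mono) simp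
      also have "\<dots> = 8 ^ Suc (card (A m)) * n" using m by simp
      also have "\<dots> \<le> 8 ^ card (A n) * n" using c by (intro mult_right_mono power_increasing) auto
      finally show ?thesis .
    next
      case False
      have "Suc e ^ 3 \<le> 8 ^ e" by (rule Suc_cubed_le_power_8)
      also have "\<dots> \<le> p ^ e" using False by (simp add: power_mono)
      finally have "Suc e ^ 3 * (8 ^ card (A m) * m) \<le> p ^ e * (8 ^ card (A m) * m)" by (rule mult_right_mono) simp
      also have "\<dots> = 8 ^ (card (A m)) * n" using m by simp
      also have "\<dots> \<le> 8 ^ card (A n) * n" 
        using m by (intro mult_right_mono power_increasing card_mono fin) (auto simp: A_def)
      finally show ?thesis .
    qed
    finally show ?thesis by (simp add: A_def)
  qed
qed

text \<open>4096 = 8^4: the primes below 8 are 2, 3, 5 and 7, and each costs at most one factor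
  8.\<close>

lemma card_divisors_cubed:
  fixes n :: nat
  assumes "n > 0"
  shows "card {d. d dvd n} ^ 3 \<le> 4096 * n"
proof -
  have "prime p \<and> p dvd n \<and> p < 8 \<Longrightarrow> p \<in> {2, 3, 5, 7}" for p :: nat
  proof -
    assume a: "prime p \<and> p dvd n \<and> p < 8"
    then have "p \<in> {0,1,2,3,4,5,6,7}" by auto
    moreover have "\<not> prime (4::nat)" "\<not> prime (6::nat)" by (auto simp: prime_nat_iff intro: exI[of _ 2])
    ultimately show ?thesis using a by auto
  qed
  then have "card {p. prime p \<and> p dvd n \<and> p < 8} \<le> card {2, 3, 5, 7 :: nat}"
    by (intro card_mono) auto
  then have "(8::nat) ^ card {p. prime p \<and> p dvd n \<and> p < 8} \<le> 8 ^ 4" by (intro power_increasing) auto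
  then have "(8::nat) ^ card {p. prime p \<and> p dvd n \<and> p < 8} * n \<le> 4096 * n" by (intro mult_right_mono) auto
  with card_divisors_cubed_aux[OF assms] show ?thesis by linarith
qed

text \<open>The constant 32 is the cube root 16 of 4096, doubled because the divisors of an integer
  come with both signs.\<close>

lemma card_int_divisors_cubed:
  fixes n :: int
  assumes "n \<noteq> 0"
  shows "finite {d. d dvd n}" "real (card {d. d dvd n}) \<le> 32 * \<bar>of_int n\<bar> powr (1/3)"
proof -
  have cube_root: "(x ^ 3) powr (1/3) = x" if "x \<ge> 0" for x :: real
    using that by (cases "x = 0") (simp_all add: powr_powr flip: powr_numeral)
  define S where "S = {d. d dvd nat \<bar>n\<bar>}"
  have S: "finite S" unfolding S_def using assms by (intro finite_divisors_nat) simp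
  have sub: "{d. d dvd n} \<subseteq> int ` S \<union> (\<lambda>x. - int x) ` S"
  proof
    fix d assume "d \<in> {d. d dvd n}"
    then have "nat \<bar>d\<bar> \<in> S" by (simp add: S_def nat_abs_dvd_iff)
    moreover have "d = int (nat \<bar>d\<bar>) \<or> d = - int (nat \<bar>d\<bar>)" by linarith
    ultimately show "d \<in> int ` S \<union> (\<lambda>x. - int x) ` S" by blast
  qed
  then show "finite {d. d dvd n}" by (rule finite_subset) (use S in auto)
  have "card {d. d dvd n} \<le> card (int ` S \<union> (\<lambda>x. - int x) ` S)" by (rule card_mono[OF _ sub]) (use S in auto)
  also have "\<dots> \<le> card S + card S"
    by (intro order.trans[OF card_Un_le] add_mono card_image_le S)
  finally have c: "real (card {d. d dvd n}) \<le> 2 * real (card S)" by linarith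
  have "card S ^ 3 \<le> 4096 * nat \<bar>n\<bar>" unfolding S_def using assms by (intro card_divisors_cubed) auto
  then have "real (card S ^ 3) \<le> real (4096 * nat \<bar>n\<bar>)" by (simp only: of_nat_le_iff)
  then have "real (card S) ^ 3 \<le> 4096 * \<bar>of_int n\<bar>" by simp
  then have "(real (card S) ^ 3) powr (1/3) \<le> (4096 * \<bar>of_int n\<bar>) powr (1/3)" by (intro powr_mono2) auto
  also have "(4096 * \<bar>real_of_int n\<bar>) powr (1/3) = 16 * \<bar>real_of_int n\<bar> powr (1/3)"
    using cube_root[of 16] by (simp add: powr_mult)
  also have "(real (card S) ^ 3) powr (1/3) = real (card S)" by (rule cube_root) simp
  finally show "real (card {d. d dvd n}) \<le> 32 * \<bar>of_int n\<bar> powr (1/3)" using c by linarith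
qed

section \<open>Summation over forms, grouped by the middle coefficient\<close>

lemma summable_on_int_powr:
  assumes "p > 1"
  shows "(\<lambda>b::int. (1 + \<bar>of_int b\<bar>) powr (-p) :: real) summable_on UNIV"
proof -
  have "summable (\<lambda>n. real n powr (-p))" using assms by (simp add: summable_real_powr_iff)
  then have "summable (\<lambda>n. real (Suc n) powr (-p))" by (subst summable_Suc_iff)
  then have 1: "(\<lambda>n. real (Suc n) powr (-p)) summable_on UNIV"
    by (subst summable_on_UNIV_nonneg_real_iff) auto
  have "(\<lambda>b::int. (1 + \<bar>of_int b\<bar>) powr (-p) :: real) summable_on range int"
    by (subst summable_on_reindex) (use 1 in \<open>auto simp: o_def add.commute\<close>)
  moreover have "(\<lambda>b::int. (1 + \<bar>of_int b\<bar>) powr (-p) :: real) summable_on range (\<lambda>n. - int n)"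
    by (subst summable_on_reindex) (use 1 in \<open>auto simp: o_def add.commute inj_on_def\<close>)
  ultimately have "(\<lambda>b::int. (1 + \<bar>of_int b\<bar>) powr (-p) :: real) summable_on (range int \<union> range (\<lambda>n. - int n))"
    by (rule summable_on_union)
  moreover have "range int \<union> range (\<lambda>n. - int n) = UNIV"
  proof -
    have "x = int (nat \<bar>x\<bar>) \<or> x = - int (nat \<bar>x\<bar>)" for x by linarith
    then show ?thesis by blast
  qed
  ultimately show ?thesis by simp
qed

lemma qforms_fst_nonzero:
  assumes "\<not> (\<exists>n::int. D = n\<^sup>2)" "(a, b, c) \<in> qforms D"
  shows "a \<noteq> 0"
  using assms by (auto simp: qforms_def)

text \<open>The common majorant, up to constants, for all series over forms. The exponent 2 is the
  smallest admissible k, so one weight serves every k > 1.\<close>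

definition qform_weight :: "qform \<Rightarrow> real" where
  "qform_weight = (\<lambda>(a, b, c). 1 / (1 + \<bar>of_int b\<bar>)\<^sup>2)"

text \<open>For fixed b the coefficient a divides b^2 - D, which is nonzero because D is not a
  square, and then c is determined. So b is shared by O((1+|b|)^(2/3)) forms, and the sum is
  dominated by that of (1+|b|)^(-4/3).\<close>

lemma qform_weight_summable:
  assumes nsq: "\<not> (\<exists>n::int. D = n\<^sup>2)"
  shows "qform_weight summable_on qforms D"
proof -
  \<comment> \<open>Some of these divisors belong to no form, since 4ac = b^2 - D asks for more than
    a dividing b^2 - D. Enlarging the index set is harmless for an absolutely convergent
    sum.\<close>
  define B where "B b = {a :: int. a dvd b\<^sup>2 - D}" for b
  define w where "w = (\<lambda>b :: int. 1 / (1 + \<bar>of_int b\<bar>)\<^sup>2 :: real)"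
  have nz: "b\<^sup>2 - D \<noteq> 0" for b using nsq by auto
  have fin: "finite (B b)" for b unfolding B_def using card_int_divisors_cubed(1)[OF nz] .
  define K :: real where "K = 32 * (1 + \<bar>of_int D\<bar>) powr (1/3)"
  have bound: "real (card (B b)) * w b \<le> K * (1 + \<bar>of_int b\<bar>) powr (-(4/3))" for b
  proof -
    define s :: real where "s = 1 + \<bar>of_int b\<bar>"
    have s: "s \<ge> 1" by (simp add: s_def)
    have "\<bar>of_int (b\<^sup>2 - D)\<bar> \<le> (of_int b)\<^sup>2 + \<bar>of_int D :: real\<bar>"
      using abs_triangle_ineq4[of "(of_int b)\<^sup>2" "of_int D :: real"] by simp
    also have "\<dots> \<le> s\<^sup>2 + \<bar>of_int D\<bar> * s\<^sup>2"
    proof (intro add_mono)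
      show "(of_int b)\<^sup>2 \<le> s\<^sup>2" using abs_le_square_iff[of "of_int b" s] s by (auto simp: s_def)
      show "\<bar>of_int D\<bar> \<le> \<bar>of_int D\<bar> * s\<^sup>2" using s mult_left_mono[of 1 "s\<^sup>2" "\<bar>of_int D\<bar>"] by simp
    qed
    finally have le: "\<bar>of_int (b\<^sup>2 - D)\<bar> \<le> (1 + \<bar>of_int D\<bar>) * s\<^sup>2" by (simp add: algebra_simps)
    have "real (card (B b)) \<le> 32 * \<bar>of_int (b\<^sup>2 - D)\<bar> powr (1/3)"
      unfolding B_def by (rule card_int_divisors_cubed(2)[OF nz])
    also have "\<dots> \<le> 32 * ((1 + \<bar>of_int D\<bar>) * s\<^sup>2) powr (1/3)" using le by (intro mult_left_mono powr_mono2) auto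
    also have "\<dots> = K * s powr (2/3)" using s unfolding K_def by (subst powr_mult) (auto simp flip: powr_numeral simp: powr_powr)
    finally have "real (card (B b)) * w b \<le> K * s powr (2/3) * w b" by (rule mult_right_mono) (auto simp: w_def)
    also have "K * s powr (2/3) * w b = K * (s powr (2/3) * s powr (-2))"
      using s by (simp add: w_def s_def powr_minus powr_numeral divide_simps)
    also have "s powr (2/3) * s powr (-2) = s powr (-(4/3))" by (simp flip: powr_add)
    finally show ?thesis unfolding s_def .
  qed
  have bound': "real (card (B b)) * \<bar>w b\<bar> \<le> K * (1 + \<bar>of_int b\<bar>) powr (-(4/3))" for b
    using bound[of b] by (simp add: w_def)
  have "(\<lambda>x. norm (case x of (b, a) \<Rightarrow> w b)) summable_on Sigma UNIV B"
    unfolding Infinite_Sum.abs_summable_on_Sigma_iff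
  proof (intro conjI ballI)
    fix b show "(\<lambda>y. norm (case (b, y) of (b, a) \<Rightarrow> w b)) summable_on B b" using fin by simp
  next
    have "(\<lambda>b. K * (1 + \<bar>of_int b\<bar>) powr (-(4/3))) summable_on (UNIV :: int set)"
      by (intro summable_on_cmult_right summable_on_int_powr) auto
    then show "(\<lambda>b. norm (\<Sum>\<^sub>\<infinity>y\<in>B b. norm (case (b, y) of (b, a) \<Rightarrow> w b))) summable_on UNIV"
      by (rule Infinite_Sum.abs_summable_on_comparison_test') (use bound' fin in \<open>simp add: infsum_nonneg\<close>)
  qed
  then have "(\<lambda>(b, a). w b) summable_on Sigma UNIV B" by (rule abs_summable_summable)
  then have "(\<lambda>(b, a). w b) summable_on (\<lambda>(a, b, c). (b, a)) ` qforms D"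
    by (rule summable_on_subset_banach) (auto simp: B_def qforms_def)
  moreover have "inj_on (\<lambda>(a, b, c). (b, a)) (qforms D)"
    using qforms_fst_nonzero[OF nsq] by (auto simp: inj_on_def qforms_def)
  ultimately have "((\<lambda>(b, a). w b) \<circ> (\<lambda>(a, b, c). (b, a))) summable_on qforms D"
    by (subst (asm) summable_on_reindex)
  then show ?thesis by (simp add: o_def w_def case_prod_unfold qform_weight_def)
qed

section \<open>Bounds for the individual terms\<close>

lemma qform_circle_alt:
  "qform_circle (a, b, c) z = of_int a * ((Re z)\<^sup>2 + (Im z)\<^sup>2) + of_int b * Re z + of_int c"
  by (simp add: cmod_power2)

lemma Re_qform_eval: "Re (qform_eval (a, b, c) z 1) = of_int a * ((Re z)\<^sup>2 - (Im z)\<^sup>2) + of_int b * Re z + of_int c"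
  and Im_qform_eval: "Im (qform_eval (a, b, c) z 1) = Im z * (2 * of_int a * Re z + of_int b)"
  by (simp_all add: power2_eq_square algebra_simps)

lemma norm_qform_eval_power2:
  assumes "Q \<in> qforms D"
  shows "(cmod (qform_eval Q z 1))\<^sup>2 = of_int D * (Im z)\<^sup>2 + (qform_circle Q z)\<^sup>2"
proof -
  obtain a b c where Q: "Q = (a, b, c)" by (cases Q)
  have D: "real_of_int D = (of_int b)\<^sup>2 - 4 * of_int a * of_int c"
    using assms by (auto simp: Q qforms_def)
  show ?thesis unfolding Q cmod_power2 Re_qform_eval Im_qform_eval qform_circle_alt D
    by (simp add: power2_eq_square algebra_simps)
qed

lemma norm_qform_eval_ge:
  assumes "Q \<in> qforms D" "D > 0" "Im z > 0"
  shows "sqrt (of_int D) * Im z \<le> cmod (qform_eval Q z 1)" "\<bar>qform_circle Q z\<bar> \<le> cmod (qform_eval Q z 1)"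
    "cmod (qform_eval Q z 1) > 0" "qform_eval Q z 1 \<noteq> 0"
proof -
  show 1: "sqrt (of_int D) * Im z \<le> cmod (qform_eval Q z 1)"
    by (rule power2_le_imp_le) (use assms in \<open>auto simp: norm_qform_eval_power2[OF assms(1)] power_mult_distrib\<close>)
  show "\<bar>qform_circle Q z\<bar> \<le> cmod (qform_eval Q z 1)"
    by (rule power2_le_imp_le) (use assms in \<open>auto simp: norm_qform_eval_power2[OF assms(1)]\<close>)
  have "0 < sqrt (of_int D) * Im z" using assms by simp
  with 1 show "cmod (qform_eval Q z 1) > 0" by linarith
  then show "qform_eval Q z 1 \<noteq> 0" by auto
qed

text \<open>The circle polynomial and Re Q(z,1) differ by 2ay^2 and both are at most |Q(z,1)| in
  absolute value, which bounds a. Then Im Q(z,1) = y(2ax+b) bounds b.\<close>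

lemma qform_middle_coeff_bound:
  assumes Q: "(a, b, c) \<in> qforms D" and "D > 0" and y0: "0 < y0" "y0 \<le> Im z" and X: "\<bar>Re z\<bar> \<le> X"
  shows "\<bar>of_int b\<bar> \<le> (1 / y0 + 2 * X / y0\<^sup>2) * cmod (qform_eval (a, b, c) z 1)"
proof -
  define N where "N = cmod (qform_eval (a, b, c) z 1)"
  have y: "Im z > 0" using y0 by simp
  have N0: "N \<ge> 0" by (simp add: N_def)
  have "\<bar>qform_circle (a, b, c) z - Re (qform_eval (a, b, c) z 1)\<bar> \<le> N + N"
    using norm_qform_eval_ge(2)[OF Q \<open>D > 0\<close> y] abs_Re_le_cmod[of "qform_eval (a, b, c) z 1"]
    unfolding N_def by linarith
  also have "qform_circle (a, b, c) z - Re (qform_eval (a, b, c) z 1) = 2 * (of_int a * (Im z)\<^sup>2)"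
    unfolding qform_circle_alt Re_qform_eval by (simp add: algebra_simps)
  finally have "\<bar>of_int a\<bar> * (Im z)\<^sup>2 \<le> N" by (simp add: abs_mult)
  then have "\<bar>of_int a\<bar> * y0\<^sup>2 \<le> N"
    using mult_left_mono[of "y0\<^sup>2" "(Im z)\<^sup>2" "\<bar>of_int a\<bar>"] y0 by (simp add: power_mono)
  then have a: "\<bar>of_int a\<bar> \<le> N / y0\<^sup>2" using y0 by (simp add: field_simps)
  have "\<bar>Im z * (2 * of_int a * Re z + of_int b)\<bar> \<le> N"
    using abs_Im_le_cmod[of "qform_eval (a, b, c) z 1"] unfolding N_def Im_qform_eval .
  then have "Im z * \<bar>2 * of_int a * Re z + of_int b\<bar> \<le> N" using y by (simp add: abs_mult)
  then have "y0 * \<bar>2 * of_int a * Re z + of_int b\<bar> \<le> N"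
    using mult_right_mono[OF y0(2), of "\<bar>2 * of_int a * Re z + of_int b\<bar>"] by simp
  then have b: "\<bar>2 * of_int a * Re z + of_int b\<bar> \<le> N / y0" using y0 by (simp add: field_simps)
  have "\<bar>2 * of_int a * Re z\<bar> \<le> 2 * (N / y0\<^sup>2) * X"
    unfolding abs_mult using a X N0 y0 by (intro mult_mono) auto
  with b have "\<bar>of_int b\<bar> \<le> N / y0 + 2 * (N / y0\<^sup>2) * X" by linarith
  also have "\<dots> = (1 / y0 + 2 * X / y0\<^sup>2) * N" by (simp add: algebra_simps)
  finally show ?thesis by (simp add: N_def)
qed

text \<open>The first summand pays for the 1 in 1+|b|, through |Q(z,1)| >= sqrt(D) y; the rest pays
  for |b|. Only a lower bound for y and an upper bound for |x| enter, so the constant is uniform on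
  half-strips.\<close>

definition qform_const :: "int \<Rightarrow> real \<Rightarrow> real \<Rightarrow> real" where
  "qform_const D y0 X = 1 / (sqrt (of_int D) * y0) + (1 / y0 + 2 * X / y0\<^sup>2)"

lemma qform_const_bound:
  assumes Q: "(a, b, c) \<in> qforms D" and D: "D > 0" and y0: "0 < y0" "y0 \<le> Im z" and X: "\<bar>Re z\<bar> \<le> X"
  shows "1 + \<bar>of_int b\<bar> \<le> qform_const D y0 X * cmod (qform_eval (a, b, c) z 1)"
proof -
  have "sqrt (of_int D) * y0 \<le> sqrt (of_int D) * Im z" using y0 D by simp
  also have "\<dots> \<le> cmod (qform_eval (a, b, c) z 1)" using norm_qform_eval_ge[OF Q D] y0 by auto
  finally have "1 \<le> 1 / (sqrt (of_int D) * y0) * cmod (qform_eval (a, b, c) z 1)"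
    using y0 D by (simp add: field_simps)
  with qform_middle_coeff_bound[OF assms] show ?thesis by (simp add: qform_const_def algebra_simps)
qed

text \<open>Since 1+|b| >= 1, the power k can be lowered to 2 on the side of the weight: (1+|b|)^2
  <= (1+|b|)^k <= (K |Q(z,1)|)^k, where K is the value of \<open>qform_const\<close>.\<close>

lemma inverse_norm_qform_eval_power_le:
  assumes Q: "Q \<in> qforms D" and D: "D > 0" and y0: "0 < y0" "y0 \<le> Im z" and X: "\<bar>Re z\<bar> \<le> X" and k: "k \<ge> 2"
  shows "inverse (cmod (qform_eval Q z 1) ^ k) \<le> qform_const D y0 X ^ k * qform_weight Q"
proof -
  obtain a b c where abc: "Q = (a, b, c)" by (cases Q)
  define N where "N = cmod (qform_eval Q z 1)"
  define K where "K = qform_const D y0 X"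
  define s :: real where "s = 1 + \<bar>of_int b\<bar>"
  have N: "N > 0" using norm_qform_eval_ge(3)[OF Q D] y0 by (auto simp: N_def)
  have s: "s \<le> K * N" "s \<ge> 1" using qform_const_bound[OF Q[unfolded abc] D y0 X] by (auto simp: s_def K_def N_def abc)
  have "s\<^sup>2 \<le> s ^ k" using s k by (intro power_increasing) auto
  also have "\<dots> \<le> (K * N) ^ k" using s by (intro power_mono) auto
  finally have "s\<^sup>2 \<le> K ^ k * N ^ k" by (simp add: power_mult_distrib)
  then have "inverse (N ^ k) \<le> K ^ k * (1 / s\<^sup>2)" using N s by (simp add: field_simps)
  then show ?thesis by (simp add: qform_weight_def abc s_def N_def K_def)
qed

section \<open>The incomplete beta function \<open>psi\<close> and the size of a summand\<close>

lemma psi_argument_in_unit_interval: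
  assumes "Q \<in> qforms D" "D > 0" "Im z > 0"
  shows "of_int D * (Im z)\<^sup>2 / (cmod (qform_eval Q z 1))\<^sup>2 \<in> {0<..1}"
proof -
  have "of_int D * (Im z)\<^sup>2 > 0" using assms by simp
  then show ?thesis unfolding norm_qform_eval_power2[OF assms(1)]
    by (auto simp: add_pos_nonneg pos_divide_le_eq)
qed

text \<open>The primitive -2 sqrt(1-u) is continuous up to u = 1 and has to be differentiated only
  in the interior, so the improper endpoint v = 1 is included.\<close>

lemma integrable_one_minus_powr:
  assumes "0 \<le> v" "v \<le> 1"
  shows "((\<lambda>u::real. (1 - u) powr (-1/2)) has_integral (2 - 2 * sqrt (1 - v))) {0..v}"
proof -
  have "((\<lambda>u::real. (1 - u) powr (-1/2)) has_integral (- 2 * sqrt (1 - v) - (- 2 * sqrt (1 - 0)))) {0..v}"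
  proof (rule fundamental_theorem_of_calculus_interior)
    fix x assume x: "x \<in> {0<..<v}"
    have "((\<lambda>x. - 2 * sqrt (1 - x)) has_real_derivative inverse (sqrt (1 - x))) (at x)"
      using x assms by (auto intro!: derivative_eq_intros simp: field_simps)
    also have "inverse (sqrt (1 - x)) = (1 - x) powr (-1/2)"
      using x assms by (simp add: powr_minus powr_half_sqrt)
    finally show "((\<lambda>x. - 2 * sqrt (1 - x)) has_vector_derivative (1 - x) powr (-1/2)) (at x)"
      by (simp add: has_real_derivative_iff_has_vector_derivative)
  qed (use assms in \<open>auto intro!: continuous_intros\<close>)
  then show ?thesis by simp
qed

text \<open>For k > 1 the exponent k - 3/2 is positive, so the first factor is continuous and
  bounded and the only singularity is the integrable one of the second factor.\<close>

lemma psi_integrable: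
  assumes "k > 1" "v \<le> 1"
  shows "(\<lambda>u. u powr (real k - 3/2) * (1 - u) powr (-1/2)) integrable_on {0..v}"
proof (cases "0 \<le> v")
  case True
  have "(\<lambda>u. u powr (real k - 3/2) * (1 - u) powr (-1/2)) absolutely_integrable_on {0..v}"
  proof (rule absolutely_integrable_bounded_measurable_product_real)
    show "(\<lambda>u. u powr (real k - 3/2)) \<in> borel_measurable (lebesgue_on {0..v})"
      by (intro continuous_imp_measurable_on_sets_lebesgue continuous_on_powr' continuous_intros) (use assms in auto)
    show "bounded ((\<lambda>u. u powr (real k - 3/2)) ` {0..v})"
      by (intro compact_imp_bounded compact_continuous_image continuous_on_powr' continuous_intros) (use assms in auto)
    show "(\<lambda>u. (1 - u) powr (-1/2)) absolutely_integrable_on {0..v}"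
      by (rule nonnegative_absolutely_integrable_1)
        (use integrable_one_minus_powr[OF True assms(2)] in auto)
  qed auto
  then show ?thesis by (rule set_lebesgue_integral_eq_integral(1))
next
  case False
  then have "{0..v} = {}" by simp
  then show ?thesis by (simp only: integrable_on_empty)
qed

lemma continuous_on_psi:
  assumes "k > 1"
  shows "continuous_on {0..1} (psi k)"
  unfolding psi_def
  by (intro continuous_on_mult continuous_on_const indefinite_integral_continuous_1 psi_integrable)
    (use assms in auto)

text \<open>Replace u^(k-3/2) by its maximum v^(k-3/2) and integrate the singular factor exactly.
  The remaining 2 - 2 sqrt(1-v) is at most 2v because 1-v <= sqrt(1-v).\<close>

lemma psi_bounds:
  assumes "k > 1" "0 \<le> v" "v \<le> 1"
  shows "0 \<le> psi k v" "psi k v \<le> v powr (real k - 1/2)"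
proof -
  show "0 \<le> psi k v" unfolding psi_def
    by (intro mult_nonneg_nonneg integral_nonneg psi_integrable) (use assms in auto)
  have "integral {0..v} (\<lambda>u. u powr (real k - 3/2) * (1 - u) powr (-1/2))
      \<le> integral {0..v} (\<lambda>u. v powr (real k - 3/2) * (1 - u) powr (-1/2))"
    using integrable_one_minus_powr[OF assms(2,3)] assms
    by (intro integral_le psi_integrable mult_right_mono powr_mono2) (auto intro!: integrable_on_mult_right)
  also have "\<dots> = v powr (real k - 3/2) * (2 - 2 * sqrt (1 - v))"
    using integrable_one_minus_powr[OF assms(2,3)] by (simp add: integral_unique)
  also have "\<dots> \<le> v powr (real k - 3/2) * (2 * v)"
  proof (intro mult_left_mono)
    have "(1 - v) \<le> sqrt (1 - v)" using assms by (intro real_le_rsqrt) (auto simp: power2_eq_square mult_left_le)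
    then show "2 - 2 * sqrt (1 - v) \<le> 2 * v" by simp
  qed simp
  also have "\<dots> = 2 * v powr (real k - 1/2)"
    using assms by (cases "v = 0") (auto simp: powr_diff powr_mult_base field_simps powr_add[symmetric] simp flip: powr_one_gt_zero_iff)
  finally show "psi k v \<le> v powr (real k - 1/2)" unfolding psi_def by simp
qed

lemma psi_has_real_derivative:
  assumes "k > 1" "0 < v" "v < 1"
  shows "(psi k has_real_derivative (1/2 * (v powr (real k - 3/2) * (1 - v) powr (-1/2)))) (at v)"
proof -
  \<comment> \<open>The differentiation theorem asks for a continuous integrand on a closed
    interval; stopping halfway between \<open>v\<close> and 1 avoids the singularity.\<close>
  define w where "w = (1 + v) / 2"
  have w: "v < w" "w < 1" using assms by (auto simp: w_def)
  have "((\<lambda>v. integral {0..v} (\<lambda>u. u powr (real k - 3/2) * (1 - u) powr (-1/2))) has_real_derivative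
      v powr (real k - 3/2) * (1 - v) powr (-1/2)) (at v within {0..w})"
    by (rule integral_has_real_derivative)
      (use assms w in \<open>auto intro!: continuous_intros continuous_on_powr'\<close>)
  moreover have "at v within {0..w} = at v" using w assms by (intro at_within_interior) auto
  ultimately show ?thesis unfolding psi_def[abs_def]
    by (intro DERIV_cmult) simp
qed

text \<open>The bound psi(v) <= v^(k-1/2) contributes |Q(z,1)|^(-(2k-1)), which turns the growing
  factor |Q(z,1)|^(k-1) into the decaying |Q(z,1)|^(-k).\<close>

lemma norm_F_summand_le:
  assumes k: "k > 1" and Q: "Q \<in> qforms D" and D: "D > 0" and y: "Im z > 0"
  shows "cmod (F_summand k D z Q) \<le> (of_int D * (Im z)\<^sup>2) powr (real k - 1/2) * inverse (cmod (qform_eval Q z 1) ^ k)"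
proof -
  define N where "N = cmod (qform_eval Q z 1)"
  define d where "d = of_int D * (Im z)\<^sup>2"
  have N: "N > 0" unfolding N_def by (rule norm_qform_eval_ge[OF Q D y])
  have d: "d > 0" using D y by (simp add: d_def)
  have v: "d / N\<^sup>2 \<in> {0<..1}" unfolding d_def N_def by (rule psi_argument_in_unit_interval[OF Q D y])
  have "cmod (F_summand k D z Q) = \<bar>sgn (qform_circle Q z)\<bar> * (N ^ (k - 1) * psi k (d / N\<^sup>2))"
    using psi_bounds(1)[OF k, of "d / N\<^sup>2"] v by (simp add: F_summand_def norm_mult norm_power N_def d_def)
  also have "\<dots> \<le> 1 * (N ^ (k - 1) * (d / N\<^sup>2) powr (real k - 1/2))"
    using v N psi_bounds[OF k, of "d / N\<^sup>2"] by (intro mult_mono) (auto simp: sgn_if)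
  also have "\<dots> = N ^ (k - 1) * (d powr (real k - 1/2) / N ^ (2 * k - 1))"
  proof -
    have "(N\<^sup>2) powr (real k - 1/2) = (N powr 2) powr (real k - 1/2)" using N by simp
    also have "\<dots> = N powr real (2 * k - 1)" using k by (subst powr_powr) (auto simp: of_nat_diff)
    also have "\<dots> = N ^ (2 * k - 1)" using N by (rule powr_realpow)
    finally show ?thesis using d N by (simp add: powr_divide)
  qed
  also have "2 * k - 1 = (k - 1) + k" using k by simp
  also have "N ^ (k - 1) * (d powr (real k - 1/2) / N ^ (k - 1 + k)) = d powr (real k - 1/2) * inverse (N ^ k)"
    using N by (simp add: power_add field_simps)
  finally show ?thesis by (simp add: N_def d_def)
qed

lemma norm_F_summand_le_weight:
  assumes k: "k > 1" and Q: "Q \<in> qforms D" and D: "D > 0" and y0: "0 < y0" "y0 \<le> Im z"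
    and X: "\<bar>Re z\<bar> \<le> X" and Y: "Im z \<le> Y"
  shows "cmod (F_summand k D z Q) \<le> (of_int D * Y\<^sup>2) powr (real k - 1/2) * qform_const D y0 X ^ k * qform_weight Q"
proof -
  have "cmod (F_summand k D z Q) \<le> (of_int D * (Im z)\<^sup>2) powr (real k - 1/2) * inverse (cmod (qform_eval Q z 1) ^ k)"
    using y0 by (intro norm_F_summand_le k Q D) auto
  also have "\<dots> \<le> (of_int D * Y\<^sup>2) powr (real k - 1/2) * (qform_const D y0 X ^ k * qform_weight Q)"
    using k y0 X Y D
    by (intro mult_mono powr_mono2 mult_left_mono power_mono inverse_norm_qform_eval_power_le Q) auto
  finally show ?thesis by simp
qed

section \<open>Double power series\<close>

text \<open>Regroups a sum along the fibres of \<open>h\<close>. It is used with degree maps: for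
  the Cauchy product, and for collecting monomials of equal total degree.\<close>

lemma has_sum_fibres_iff:
  "(f has_sum S) UNIV \<longleftrightarrow> ((\<lambda>(y, x). f x) has_sum S) (Sigma UNIV (\<lambda>y. {x. h x = y}))"
proof -
  have "bij_betw (\<lambda>x. (h x, x)) UNIV (Sigma UNIV (\<lambda>y. {x. h x = y}))"
    by (rule bij_betwI[where g = snd]) auto
  from has_sum_reindex_bij_betw[OF this, of "\<lambda>(y, x). f x" S] show ?thesis by simp
qed

text \<open>Unconditional summability of complex families is absolute, so the product family is
  absolutely summable and may be summed iteratively.\<close>

lemma has_sum_times:
  fixes f :: "'a \<Rightarrow> complex" and g :: "'b \<Rightarrow> complex"
  assumes f: "(f has_sum a) A" and g: "(g has_sum b) B"
  shows "((\<lambda>(i, j). f i * g j) has_sum a * b) (A \<times> B)"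
proof (rule has_sum_SigmaI)
  show "((\<lambda>y. case (x, y) of (i, j) \<Rightarrow> f i * g j) has_sum f x * b) B" for x
    using has_sum_cmult_right[OF g] by simp
  show "((\<lambda>x. f x * b) has_sum a * b) A" by (rule has_sum_cmult_left[OF f])
  have fa: "(\<lambda>i. norm (f i)) summable_on A" and ga: "(\<lambda>i. norm (g i)) summable_on B"
    using has_sum_imp_summable[OF f] has_sum_imp_summable[OF g]
    by (simp_all only: summable_on_iff_abs_summable_on_complex)
  have "(\<lambda>x. norm (case x of (i, j) \<Rightarrow> f i * g j)) summable_on A \<times> B"
    unfolding Infinite_Sum.abs_summable_on_Sigma_iff
  proof (intro conjI ballI)
    show "(\<lambda>y. norm (case (x, y) of (i, j) \<Rightarrow> f i * g j)) summable_on B" for x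
      using summable_on_cmult_right[OF ga] by (simp add: norm_mult)
    have "(\<lambda>x. norm (f x) * (\<Sum>\<^sub>\<infinity>y\<in>B. norm (g y))) summable_on A"
      by (rule summable_on_cmult_left[OF fa])
    then show "(\<lambda>x. norm (\<Sum>\<^sub>\<infinity>y\<in>B. norm (case (x, y) of (i, j) \<Rightarrow> f i * g j))) summable_on A"
      by (simp add: norm_mult infsum_cmult_right' infsum_nonneg)
  qed
  then show "(\<lambda>(i, j). f i * g j) summable_on A \<times> B" by (rule abs_summable_summable)
qed

section \<open>Closure properties of real analytic functions\<close>

lemma real_analytic_on_cong:
  assumes F: "real_analytic_on F U" and U: "open U" and eq: "\<And>z. z \<in> U \<Longrightarrow> F z = G z"
  shows "real_analytic_on G U"
  unfolding real_analytic_on_def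
proof
  fix z assume z: "z \<in> U"
  obtain e where e: "e > 0" "ball z e \<subseteq> U" using U z by (meson open_contains_ball)
  obtain r c where r: "r > 0" and c: "\<And>s t :: real. \<bar>s\<bar> < r \<Longrightarrow> \<bar>t\<bar> < r \<Longrightarrow>
        ((\<lambda>(m, n). c (m, n) * of_real (s ^ m * t ^ n)) has_sum F (z + Complex s t)) UNIV"
    using F z unfolding real_analytic_on_def by blast
  \<comment> \<open>Halving the radius suffices because |s + it| <= |s| + |t|.\<close>
  have "z + Complex s t \<in> U" if "\<bar>s\<bar> < e / 2" "\<bar>t\<bar> < e / 2" for s t
    using complex_norm_square cmod_le[of "Complex s t"] that e by (auto simp: dist_norm subset_eq)
  then have "\<forall>s t. \<bar>s\<bar> < min r (e / 2) \<longrightarrow> \<bar>t\<bar> < min r (e / 2) \<longrightarrow>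
        ((\<lambda>(m, n). c (m, n) * of_real (s ^ m * t ^ n)) has_sum G (z + Complex s t)) UNIV"
    using c eq by force
  then show "\<exists>r>0. \<exists>c. \<forall>s t. \<bar>s\<bar> < r \<longrightarrow> \<bar>t\<bar> < r \<longrightarrow>
        ((\<lambda>(m, n). c (m, n) * of_real (s ^ m * t ^ n)) has_sum G (z + Complex s t)) UNIV"
    using r e by (intro exI[of _ "min r (e / 2)"]) auto
qed

lemma real_analytic_on_cnj:
  assumes F: "real_analytic_on F U"
  shows "real_analytic_on (\<lambda>z. cnj (F z)) U"
  unfolding real_analytic_on_def
proof
  fix z assume z: "z \<in> U"
  obtain r c where r: "r > 0" and c: "\<And>s t :: real. \<bar>s\<bar> < r \<Longrightarrow> \<bar>t\<bar> < r \<Longrightarrow>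
        ((\<lambda>(m, n). c (m, n) * of_real (s ^ m * t ^ n)) has_sum F (z + Complex s t)) UNIV"
    using F z unfolding real_analytic_on_def by blast
  have "((\<lambda>(m, n). cnj (c (m, n)) * of_real (s ^ m * t ^ n)) has_sum cnj (F (z + Complex s t))) UNIV"
    if "\<bar>s\<bar> < r" "\<bar>t\<bar> < r" for s t
    using c[OF that] by (subst (asm) has_sum_cnj_iff [symmetric]) (simp add: case_prod_unfold)
  then show "\<exists>r>0. \<exists>c. \<forall>s t. \<bar>s\<bar> < r \<longrightarrow> \<bar>t\<bar> < r \<longrightarrow>
        ((\<lambda>(m, n). c (m, n) * of_real (s ^ m * t ^ n)) has_sum cnj (F (z + Complex s t))) UNIV"
    using r by (intro exI[of _ r] conjI exI[of _ "\<lambda>p. cnj (c p)"]) auto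
qed

lemma real_analytic_on_add:
  assumes F: "real_analytic_on F U" and G: "real_analytic_on G U"
  shows "real_analytic_on (\<lambda>z. F z + G z) U"
  unfolding real_analytic_on_def
proof
  fix z assume z: "z \<in> U"
  obtain r c where r: "r > 0" and c: "\<And>s t :: real. \<bar>s\<bar> < r \<Longrightarrow> \<bar>t\<bar> < r \<Longrightarrow>
        ((\<lambda>(m, n). c (m, n) * of_real (s ^ m * t ^ n)) has_sum F (z + Complex s t)) UNIV"
    using F z unfolding real_analytic_on_def by blast
  obtain q d where q: "q > 0" and d: "\<And>s t :: real. \<bar>s\<bar> < q \<Longrightarrow> \<bar>t\<bar> < q \<Longrightarrow>
        ((\<lambda>(m, n). d (m, n) * of_real (s ^ m * t ^ n)) has_sum G (z + Complex s t)) UNIV"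
    using G z unfolding real_analytic_on_def by blast
  have "((\<lambda>(m, n). (c (m, n) + d (m, n)) * of_real (s ^ m * t ^ n)) has_sum
      (F (z + Complex s t) + G (z + Complex s t))) UNIV"
    if "\<bar>s\<bar> < min r q" "\<bar>t\<bar> < min r q" for s t
    using has_sum_add[OF c d, of s t s t] that by (simp add: case_prod_unfold ring_distribs)
  then show "\<exists>r>0. \<exists>c. \<forall>s t. \<bar>s\<bar> < r \<longrightarrow> \<bar>t\<bar> < r \<longrightarrow>
        ((\<lambda>(m, n). c (m, n) * of_real (s ^ m * t ^ n)) has_sum (F (z + Complex s t) + G (z + Complex s t))) UNIV"
    using r q by (intro exI[of _ "min r q"] conjI exI[of _ "\<lambda>p. c p + d p"]) auto
qed

lemma real_analytic_on_mult:
  assumes F: "real_analytic_on F U" and G: "real_analytic_on G U"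
  shows "real_analytic_on (\<lambda>z. F z * G z) U"
  unfolding real_analytic_on_def
proof
  fix z assume z: "z \<in> U"
  obtain r c where r: "r > 0" and c: "\<And>s t :: real. \<bar>s\<bar> < r \<Longrightarrow> \<bar>t\<bar> < r \<Longrightarrow>
        ((\<lambda>(m, n). c (m, n) * of_real (s ^ m * t ^ n)) has_sum F (z + Complex s t)) UNIV"
    using F z unfolding real_analytic_on_def by blast
  obtain q d where q: "q > 0" and d: "\<And>s t :: real. \<bar>s\<bar> < q \<Longrightarrow> \<bar>t\<bar> < q \<Longrightarrow>
        ((\<lambda>(m, n). d (m, n) * of_real (s ^ m * t ^ n)) has_sum G (z + Complex s t)) UNIV"
    using G z unfolding real_analytic_on_def by blast
  \<comment> \<open>\<open>h\<close> adds the exponents of two monomials. Its fibres are finite, so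
    each coefficient \<open>e p\<close> of the Cauchy product is a finite sum.\<close>
  define h :: "(nat \<times> nat) \<times> nat \<times> nat \<Rightarrow> nat \<times> nat"
    where "h = (\<lambda>((m, n), (m', n')). (m + m', n + n'))"
  define e where "e p = (\<Sum>x | h x = p. c (fst x) * d (snd x))" for p
  have fin: "finite {x. h x = p}" for p
    by (rule finite_subset[of _ "({..fst p} \<times> {..snd p}) \<times> ({..fst p} \<times> {..snd p})"]) (auto simp: h_def)
  have "((\<lambda>(m, n). e (m, n) * of_real (s ^ m * t ^ n)) has_sum
      (F (z + Complex s t) * G (z + Complex s t))) UNIV"
    if st: "\<bar>s\<bar> < min r q" "\<bar>t\<bar> < min r q" for s t
  proof -
    define G' where "G' = (\<lambda>x. (c (fst x) * d (snd x)) * of_real (s ^ fst (h x) * t ^ snd (h x)))"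
    have "((\<lambda>(i, j). (case i of (m, n) \<Rightarrow> c (m, n) * of_real (s ^ m * t ^ n)) *
        (case j of (m, n) \<Rightarrow> d (m, n) * of_real (s ^ m * t ^ n))) has_sum
      (F (z + Complex s t) * G (z + Complex s t))) (UNIV \<times> UNIV)"
      using has_sum_times[OF c d, of s t s t] st by simp
    also have "(\<lambda>(i, j). (case i of (m, n) \<Rightarrow> c (m, n) * of_real (s ^ m * t ^ n)) *
        (case j of (m, n) \<Rightarrow> d (m, n) * of_real (s ^ m * t ^ n))) = G'"
      by (auto simp: fun_eq_iff G'_def h_def power_add)
    finally have "((\<lambda>(y, x). G' x) has_sum (F (z + Complex s t) * G (z + Complex s t)))
        (Sigma UNIV (\<lambda>y. {x. h x = y}))"
      by (simp add: has_sum_fibres_iff[of _ _ h])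
    moreover have "((\<lambda>x. case (p, x) of (y, x) \<Rightarrow> G' x) has_sum (e p * of_real (s ^ fst p * t ^ snd p))) {x. h x = p}" for p
      by (rule has_sum_finiteI[OF fin]) (auto simp: e_def G'_def sum_distrib_right intro!: sum.cong)
    ultimately have "((\<lambda>p. e p * of_real (s ^ fst p * t ^ snd p)) has_sum
       (F (z + Complex s t) * G (z + Complex s t))) UNIV"
      by (rule has_sum_Sigma')
    then show ?thesis by (simp add: case_prod_unfold)
  qed
  then show "\<exists>r>0. \<exists>c. \<forall>s t. \<bar>s\<bar> < r \<longrightarrow> \<bar>t\<bar> < r \<longrightarrow>
        ((\<lambda>(m, n). c (m, n) * of_real (s ^ m * t ^ n)) has_sum (F (z + Complex s t) * G (z + Complex s t))) UNIV"
    using r q by (intro exI[of _ "min r q"] conjI exI[of _ e]) auto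
qed

text \<open>The binomial theorem, indexed by a fibre of the total degree. Below it is applied to s
  and it for the value of the series, and to |s| and |t| for its absolute convergence.\<close>

lemma binomial_fibre:
  fixes x y :: "'a :: comm_semiring_1"
  shows "(\<Sum>(i, l) | i + l = m. of_nat ((i + l) choose i) * (x ^ i * y ^ l)) = (x + y) ^ m"
proof -
  have "(\<Sum>(i, l) | i + l = m. of_nat ((i + l) choose i) * (x ^ i * y ^ l))
      = (\<Sum>i\<le>m. of_nat (m choose i) * x ^ i * y ^ (m - i))"
    by (rule sum.reindex_bij_witness[of _ "\<lambda>i. (i, m - i)" fst]) (auto simp: mult_ac)
  then show ?thesis by (simp add: binomial_ring)
qed

text \<open>Expand each power (s+it)^m of the Taylor series. The double series is dominated by the
  Taylor series with absolute coefficients at |s|+|t|, hence the radius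
  \<open>e / 2\<close>.\<close>

lemma holomorphic_imp_real_analytic_on:
  assumes F: "F holomorphic_on U" and U: "open U"
  shows "real_analytic_on F U"
  unfolding real_analytic_on_def
proof
  fix z assume z: "z \<in> U"
  obtain e where e: "e > 0" "ball z e \<subseteq> U" using U z by (meson open_contains_ball)
  define p where "p n = (deriv ^^ n) F z / fact n" for n
  have hol: "F holomorphic_on ball z e" using F e holomorphic_on_subset by blast
  have sums: "(\<lambda>n. p n * w ^ n) sums F (z + w)" if "cmod w < e" for w
    using holomorphic_power_series[OF hol, of "z + w"] that by (simp add: p_def dist_norm)
  have absum: "summable (\<lambda>n. norm (p n * w ^ n))" if w: "cmod w < e" for w
  proof -
    obtain v where v: "cmod w < v" "v < e" using w dense by blast
    then have "summable (\<lambda>n. p n * (of_real v) ^ n)" 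
      using sums[of "of_real v"] norm_ge_zero[of w] by (auto simp: sums_iff simp del: norm_ge_zero)
    then show ?thesis by (rule powser_insidea) (use v norm_ge_zero[of w] in \<open>auto simp del: norm_ge_zero\<close>)
  qed
  define c where "c = (\<lambda>(i, l). p (i + l) * of_nat ((i + l) choose i) * \<i> ^ l)"
  define h where "h = (\<lambda>(i, l). i + l :: nat)"
  have fin: "finite {x. h x = m}" for m
    by (rule finite_subset[of _ "{..m} \<times> {..m}"]) (auto simp: h_def)
  have "((\<lambda>(m, n). c (m, n) * of_real (s ^ m * t ^ n)) has_sum F (z + Complex s t)) UNIV"
    if st: "\<bar>s\<bar> < e / 2" "\<bar>t\<bar> < e / 2" for s t
  proof -
    define g where "g = (\<lambda>(m, n). c (m, n) * complex_of_real (s ^ m * t ^ n))"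
    have g: "g (i, l) = p (i + l) * (of_nat ((i + l) choose i) * (of_real s ^ i * (\<i> * of_real t) ^ l))" for i l
      by (simp add: g_def c_def power_mult_distrib)
    have le: "cmod (Complex s t) < e" using cmod_le[of "Complex s t"] st by simp
    have fibre: "((\<lambda>x. case (m, x) of (y, x) \<Rightarrow> g x) has_sum (p m * Complex s t ^ m)) {x. h x = m}" for m
    proof (rule has_sum_finiteI[OF fin])
      have "(\<Sum>x | h x = m. case (m, x) of (y, x) \<Rightarrow> g x)
          = (\<Sum>(i, l) | i + l = m. p m * (of_nat ((i + l) choose i) * (of_real s ^ i * (\<i> * of_real t) ^ l)))"
        by (rule sum.cong) (auto simp: h_def g)
      also have "\<dots> = p m * (\<Sum>(i, l) | i + l = m. of_nat ((i + l) choose i) * (of_real s ^ i * (\<i> * of_real t) ^ l))"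
        by (simp add: sum_distrib_left case_prod_unfold)
      finally show "p m * Complex s t ^ m = (\<Sum>x | h x = m. case (m, x) of (y, x) \<Rightarrow> g x)"
        by (simp add: binomial_fibre complex_eq_iff[of "Complex s t" "of_real s + \<i> * of_real t", simplified])
    qed
    have fibre': "(\<Sum>\<^sub>\<infinity>x | h x = m. norm (g x)) = norm (p m * of_real (\<bar>s\<bar> + \<bar>t\<bar>) ^ m)" for m
    proof -
      have "(\<Sum>\<^sub>\<infinity>x | h x = m. norm (g x)) = (\<Sum>x | h x = m. norm (g x))" using fin by simp
      also have "\<dots> = (\<Sum>(i, l) | i + l = m. norm (p m) * (of_nat ((i + l) choose i) * (\<bar>s\<bar> ^ i * \<bar>t\<bar> ^ l)))"
        by (rule sum.cong) (auto simp: h_def g norm_mult norm_power)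
      also have "\<dots> = norm (p m) * (\<Sum>(i, l) | i + l = m. of_nat ((i + l) choose i) * (\<bar>s\<bar> ^ i * \<bar>t\<bar> ^ l))"
        by (simp add: sum_distrib_left case_prod_unfold)
      also have "\<dots> = norm (p m * of_real (\<bar>s\<bar> + \<bar>t\<bar>) ^ m)"
        unfolding binomial_fibre norm_mult norm_power norm_of_real by simp
      finally show ?thesis .
    qed
    have "(\<lambda>x. norm (case x of (y, x) \<Rightarrow> g x)) summable_on (Sigma UNIV (\<lambda>y. {x. h x = y}))"
      unfolding Infinite_Sum.abs_summable_on_Sigma_iff
    proof (intro conjI ballI)
      show "(\<lambda>x. norm (case (m, x) of (y, x) \<Rightarrow> g x)) summable_on {x. h x = m}" for m
        using fin by simp
      have "summable (\<lambda>m. norm (p m * of_real (\<bar>s\<bar> + \<bar>t\<bar>) ^ m))"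
        by (rule absum) (use st in \<open>simp del: of_real_add\<close>)
      then show "(\<lambda>x. norm (\<Sum>\<^sub>\<infinity>y | h y = x. norm (case (x, y) of (y, x) \<Rightarrow> g x))) summable_on UNIV"
        by (simp add: fibre' summable_on_UNIV_nonneg_real_iff del: of_real_add)
    qed
    then have summ: "(\<lambda>(y, x). g x) summable_on (Sigma UNIV (\<lambda>y. {x. h x = y}))"
      by (rule abs_summable_summable)
    have "((\<lambda>m. p m * Complex s t ^ m) has_sum F (z + Complex s t)) UNIV"
      by (rule norm_summable_imp_has_sum[OF absum[OF le] sums[OF le]])
    from has_sum_SigmaI[OF fibre this summ] show ?thesis
      by (simp add: has_sum_fibres_iff[of _ _ h] g_def)
  qed
  then show "\<exists>r>0. \<exists>c. \<forall>s t. \<bar>s\<bar> < r \<longrightarrow> \<bar>t\<bar> < r \<longrightarrow>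
        ((\<lambda>(m, n). c (m, n) * of_real (s ^ m * t ^ n)) has_sum F (z + Complex s t)) UNIV"
    using e by (intro exI[of _ "e / 2"] conjI exI[of _ c]) auto
qed

lemma real_analytic_on_sum:
  assumes "finite I" "open U" "\<And>i. i \<in> I \<Longrightarrow> real_analytic_on (F i) U"
  shows "real_analytic_on (\<lambda>z. \<Sum>i\<in>I. F i z) U"
  using assms(1,3)
proof (induction I rule: finite_induct)
  case empty
  then show ?case using holomorphic_imp_real_analytic_on[OF _ assms(2), of "\<lambda>_. 0"] by simp
qed (simp add: real_analytic_on_add)

section \<open>Wirtinger derivatives\<close>

text \<open>The numbers \<open>p\<close> and \<open>q\<close> are the values of \<open>\<partial>F/\<partial>\<tau>\<close> and \<open>\<partial>F/\<partial>\<tau>\<^sup>*\<close>, where \<open>\<tau>\<^sup>*\<close> is the conjugate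
  of \<open>\<tau>\<close>.\<close>

definition has_wirtinger_derivatives ::
    "(complex \<Rightarrow> complex) \<Rightarrow> complex \<Rightarrow> complex \<Rightarrow> complex \<Rightarrow> bool" where
  "has_wirtinger_derivatives F p q z \<longleftrightarrow> (F has_derivative (\<lambda>h. p * h + q * cnj h)) (at z)"

lemma has_wirtinger_derivatives_holomorphic:
  "(F has_field_derivative p) (at z) \<longleftrightarrow> has_wirtinger_derivatives F p 0 z"
  by (simp add: has_wirtinger_derivatives_def has_field_derivative_def)

lemma has_wirtinger_derivatives_cnj:
  assumes "has_wirtinger_derivatives F p q z"
  shows "has_wirtinger_derivatives (\<lambda>z. cnj (F z)) (cnj q) (cnj p) z"
proof -
  have "((\<lambda>z. cnj (F z)) has_derivative (\<lambda>h. cnj (p * h + q * cnj h))) (at z)"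
    using assms unfolding has_wirtinger_derivatives_def
    by (rule bounded_linear.has_derivative[OF bounded_linear_cnj])
  then show ?thesis by (simp add: has_wirtinger_derivatives_def add.commute)
qed

lemma has_wirtinger_derivatives_add:
  assumes "has_wirtinger_derivatives F p q z" "has_wirtinger_derivatives G p' q' z"
  shows "has_wirtinger_derivatives (\<lambda>z. F z + G z) (p + p') (q + q') z"
  using has_derivative_add[OF assms[unfolded has_wirtinger_derivatives_def]]
  by (simp add: has_wirtinger_derivatives_def algebra_simps)

lemma has_wirtinger_derivatives_diff:
  assumes "has_wirtinger_derivatives F p q z" "has_wirtinger_derivatives G p' q' z"
  shows "has_wirtinger_derivatives (\<lambda>z. F z - G z) (p - p') (q - q') z"
  using has_derivative_diff[OF assms[unfolded has_wirtinger_derivatives_def]]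
  by (simp add: has_wirtinger_derivatives_def algebra_simps)

lemma has_wirtinger_derivatives_mult:
  assumes "has_wirtinger_derivatives F p q z" "has_wirtinger_derivatives G p' q' z"
  shows "has_wirtinger_derivatives (\<lambda>z. F z * G z) (p * G z + F z * p') (q * G z + F z * q') z"
  using has_derivative_mult[OF assms[unfolded has_wirtinger_derivatives_def]]
  by (simp add: has_wirtinger_derivatives_def algebra_simps)

lemma has_wirtinger_derivatives_const: "has_wirtinger_derivatives (\<lambda>_. c) 0 0 z"
  by (simp add: has_wirtinger_derivatives_def)

lemma has_wirtinger_derivatives_cmult:
  assumes "has_wirtinger_derivatives F p q z"
  shows "has_wirtinger_derivatives (\<lambda>z. c * F z) (c * p) (c * q) z"
  using has_wirtinger_derivatives_mult[OF has_wirtinger_derivatives_const assms] by simp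

lemma has_wirtinger_derivatives_sum:
  assumes "\<And>i. i \<in> I \<Longrightarrow> has_wirtinger_derivatives (F i) (p i) (q i) z"
  shows "has_wirtinger_derivatives (\<lambda>z. \<Sum>i\<in>I. F i z) (\<Sum>i\<in>I. p i) (\<Sum>i\<in>I. q i) z"
  using has_derivative_sum[of I F "\<lambda>i h. p i * h + q i * cnj h"] assms
  by (simp add: has_wirtinger_derivatives_def sum.distrib sum_distrib_right)

lemma has_wirtinger_derivatives_cong:
  assumes "has_wirtinger_derivatives F p q z" "open U" "z \<in> U" "\<And>w. w \<in> U \<Longrightarrow> F w = G w"
  shows "has_wirtinger_derivatives G p q z"
  using assms has_derivative_transform_within_open unfolding has_wirtinger_derivatives_def by blast

text \<open>For a real-valued \<open>t\<close> the differential ph + q cnj(h) is real, because its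
  imaginary part is the derivative of the zero function. So the real chain rule simply scales both
  Wirtinger derivatives.\<close>

lemma has_wirtinger_derivatives_of_real_compose:
  assumes "(g has_real_derivative g') (at (t z))"
    and t: "has_wirtinger_derivatives (\<lambda>z. of_real (t z)) p q z"
  shows "has_wirtinger_derivatives (\<lambda>z. of_real (g (t z))) (of_real g' * p) (of_real g' * q) z"
proof -
  have "((\<lambda>z. Re (of_real (t z))) has_derivative (\<lambda>h. Re (p * h + q * cnj h))) (at z)"
    using t unfolding has_wirtinger_derivatives_def by (rule has_derivative_Re)
  then have "(t has_derivative (\<lambda>h. Re (p * h + q * cnj h))) (at z)" by simp
  from has_derivative_compose[OF this] assms(1)
  have "((\<lambda>z. g (t z)) has_derivative (\<lambda>h. g' * Re (p * h + q * cnj h))) (at z)"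
    by (auto simp: has_field_derivative_def)
  then have 1: "((\<lambda>z. of_real (g (t z))) has_derivative (\<lambda>h. complex_of_real (g' * Re (p * h + q * cnj h)))) (at z)"
    by (rule has_derivative_of_real)
  have "((\<lambda>z. Im (of_real (t z))) has_derivative (\<lambda>h. Im (p * h + q * cnj h))) (at z)"
    using t unfolding has_wirtinger_derivatives_def by (rule has_derivative_Im)
  then have "((\<lambda>z. 0::real) has_derivative (\<lambda>h. Im (p * h + q * cnj h))) (at z)" by simp
  then have "Im (p * h + q * cnj h) = 0" for h
    using has_derivative_unique[OF _ has_derivative_const[of 0]] by metis
  then have "complex_of_real (Re (p * h + q * cnj h)) = p * h + q * cnj h" for h
    by (simp only: complex_eq_iff Re_complex_of_real Im_complex_of_real)
  then have "complex_of_real (g' * Re (p * h + q * cnj h)) = of_real g' * p * h + of_real g' * q * cnj h" for h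
    by (simp only: of_real_mult) (simp add: algebra_simps)
  with 1 show ?thesis by (simp add: has_wirtinger_derivatives_def)
qed

lemma partial_x_wirtinger:
  assumes "has_wirtinger_derivatives F p q z"
  shows "partial_x F z = p + q"
proof -
  have "((\<lambda>t. F (z + of_real t)) has_derivative (\<lambda>h. p * of_real h + q * cnj (of_real h))) (at (0::real))"
    by (rule has_derivative_compose[of "\<lambda>t. z + of_real t" of_real])
      (use assms in \<open>auto simp: has_wirtinger_derivatives_def intro!: derivative_eq_intros\<close>)
  then have "((\<lambda>t. F (z + of_real t)) has_vector_derivative (p + q)) (at (0::real))"
    by (simp add: has_vector_derivative_def scaleR_conv_of_real algebra_simps)
  then show ?thesis unfolding partial_x_def by (rule vector_derivative_at)
qed

lemma partial_y_wirtinger: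
  assumes "has_wirtinger_derivatives F p q z"
  shows "partial_y F z = \<i> * (p - q)"
proof -
  have "((\<lambda>t. F (z + \<i> * of_real t)) has_derivative (\<lambda>h. p * (\<i> * of_real h) + q * cnj (\<i> * of_real h))) (at (0::real))"
    by (rule has_derivative_compose[of "\<lambda>t. z + \<i> * of_real t" "\<lambda>h. \<i> * of_real h"])
      (use assms in \<open>auto simp: has_wirtinger_derivatives_def intro!: derivative_eq_intros\<close>)
  then have "((\<lambda>t. F (z + \<i> * of_real t)) has_vector_derivative (\<i> * (p - q))) (at (0::real))"
    by (simp add: has_vector_derivative_def scaleR_conv_of_real algebra_simps)
  then show ?thesis unfolding partial_y_def by (rule vector_derivative_at)
qed

lemma hyperbolic_laplacian_wirtinger:
  assumes U: "open U" "z \<in> U"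
    and F: "\<And>w. w \<in> U \<Longrightarrow> has_wirtinger_derivatives F (P w) (Q w) w"
    and P: "has_wirtinger_derivatives P p r z" and Q: "has_wirtinger_derivatives Q r q z"
  shows "hyperbolic_laplacian w F z = - 4 * of_real ((Im z)\<^sup>2) * r + 2 * \<i> * of_int w * of_real (Im z) * Q z"
proof -
  have px: "partial_x F w = P w + Q w" if "w \<in> U" for w using partial_x_wirtinger[OF F[OF that]] .
  have py: "partial_y F w = \<i> * (P w - Q w)" if "w \<in> U" for w using partial_y_wirtinger[OF F[OF that]] .
  have "has_wirtinger_derivatives (partial_x F) (p + r) (r + q) z"
    by (rule has_wirtinger_derivatives_cong[OF has_wirtinger_derivatives_add[OF P Q] U]) (simp add: px)
  then have 1: "partial_x (partial_x F) z = (p + r) + (r + q)" by (rule partial_x_wirtinger)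
  have "has_wirtinger_derivatives (partial_y F) (\<i> * (p - r)) (\<i> * (r - q)) z"
    by (rule has_wirtinger_derivatives_cong[OF has_wirtinger_derivatives_cmult[OF has_wirtinger_derivatives_diff[OF P Q]] U])
      (simp add: py)
  then have 2: "partial_y (partial_y F) z = \<i> * (\<i> * (p - r) - \<i> * (r - q))" by (rule partial_y_wirtinger)
  have "partial_x (partial_x F) z + partial_y (partial_y F) z = 4 * r"
    unfolding 1 2 by (simp add: algebra_simps)
  moreover have "partial_x F z + \<i> * partial_y F z = 2 * Q z"
    unfolding px[OF U(2)] py[OF U(2)] by (simp add: algebra_simps)
  ultimately show ?thesis unfolding hyperbolic_laplacian_def by simp
qed

text \<open>Domination of the terms themselves is enough, since locally uniform limits of
  holomorphic functions may be differentiated termwise. This is what singles out holomorphic pieces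
  for summation.\<close>

lemma has_field_derivative_infsum:
  fixes g g' :: "'a \<Rightarrow> complex \<Rightarrow> complex"
  assumes U: "open U" "z \<in> U"
    and der: "\<And>i w. i \<in> I \<Longrightarrow> w \<in> U \<Longrightarrow> (g i has_field_derivative g' i w) (at w)"
    and le: "\<And>i w. i \<in> I \<Longrightarrow> w \<in> U \<Longrightarrow> cmod (g i w) \<le> M i" and M: "M summable_on I"
  shows "((\<lambda>w. \<Sum>\<^sub>\<infinity>i\<in>I. g i w) has_field_derivative (\<Sum>\<^sub>\<infinity>i\<in>I. g' i z)) (at z)"
proof -
  obtain r where r: "r > 0" "cball z r \<subseteq> U" using U open_contains_cball by blast
  have ulim: "uniform_limit (cball z r) (\<lambda>S w. \<Sum>i\<in>S. g i w) (\<lambda>w. \<Sum>\<^sub>\<infinity>i\<in>I. g i w) (finite_subsets_at_top I)"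
    by (rule Weierstrass_m_test_general[OF le M]) (use r in auto)
  have "eventually (\<lambda>S. continuous_on (cball z r) (\<lambda>w. \<Sum>i\<in>S. g i w) \<and>
      (\<forall>w\<in>ball z r. ((\<lambda>w. \<Sum>i\<in>S. g i w) has_field_derivative (\<Sum>i\<in>S. g' i w)) (at w))) (finite_subsets_at_top I)"
  proof (rule eventually_finite_subsets_at_top_weakI, intro conjI ballI)
    fix S assume S: "finite S" "S \<subseteq> I"
    show "continuous_on (cball z r) (\<lambda>w. \<Sum>i\<in>S. g i w)"
      using S r der by (intro continuous_on_sum continuous_at_imp_continuous_on) (blast intro: DERIV_isCont)
    show "((\<lambda>w. \<Sum>i\<in>S. g i w) has_field_derivative (\<Sum>i\<in>S. g' i w)) (at w)" if "w \<in> ball z r" for w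
      using S r that by (intro DERIV_sum der) auto
  qed
  from has_complex_derivative_uniform_limit[OF this ulim finite_subsets_at_top_neq_bot r(1)]
  obtain G where G: "\<And>w. w \<in> ball z r \<Longrightarrow> ((\<lambda>w. \<Sum>\<^sub>\<infinity>i\<in>I. g i w) has_field_derivative G w) (at w) \<and>
     ((\<lambda>S. \<Sum>i\<in>S. g' i w) \<longlongrightarrow> G w) (finite_subsets_at_top I)" by blast
  have "((\<lambda>i. g' i z) has_sum G z) I" using G[of z] r by (simp add: has_sum_def)
  then show ?thesis using G[of z] r infsumI by force
qed

section \<open>Modularity\<close>

text \<open>The coefficients of Q(pX+qY, rX+sY), the right action of the matrix with rows (p,q) and
  (r,s).\<close>

definition qform_subst :: "int \<Rightarrow> int \<Rightarrow> int \<Rightarrow> int \<Rightarrow> qform \<Rightarrow> qform" where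
  "qform_subst p q r s = (\<lambda>(a, b, c).
     (a * p\<^sup>2 + b * p * r + c * r\<^sup>2, 2 * a * p * q + b * (p * s + q * r) + 2 * c * r * s,
      a * q\<^sup>2 + b * q * s + c * s\<^sup>2))"

lemma qform_subst_in_qforms:
  assumes "p * s - q * r = 1" "Q \<in> qforms D"
  shows "qform_subst p q r s Q \<in> qforms D"
proof -
  obtain a b c where Q: "Q = (a, b, c)" by (cases Q)
  have "(2 * a * p * q + b * (p * s + q * r) + 2 * c * r * s)\<^sup>2
      - 4 * (a * p\<^sup>2 + b * p * r + c * r\<^sup>2) * (a * q\<^sup>2 + b * q * s + c * s\<^sup>2)
      = (b\<^sup>2 - 4 * a * c) * (p * s - q * r)\<^sup>2"
    by (simp add: power2_eq_square algebra_simps)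
  with assms show ?thesis by (simp add: Q qforms_def qform_subst_def)
qed

text \<open>Composing with the adjugate matrix multiplies the form by the square of the
  determinant.\<close>

lemma qform_subst_inverse:
  assumes "p * s - q * r = 1"
  shows "qform_subst s (-q) (-r) p (qform_subst p q r s Q) = Q"
proof -
  obtain a b c where Q: "Q = (a, b, c)" by (cases Q)
  have "fst (qform_subst s (-q) (-r) p (qform_subst p q r s Q)) = a * (p * s - q * r)\<^sup>2"
    "fst (snd (qform_subst s (-q) (-r) p (qform_subst p q r s Q))) = b * (p * s - q * r)\<^sup>2"
    "snd (snd (qform_subst s (-q) (-r) p (qform_subst p q r s Q))) = c * (p * s - q * r)\<^sup>2"
    by (simp_all add: Q qform_subst_def power2_eq_square algebra_simps)
  then show ?thesis using assms by (simp add: Q prod_eq_iff)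
qed

lemma bij_betw_qform_subst:
  assumes "p * s - q * r = 1"
  shows "bij_betw (qform_subst p q r s) (qforms D) (qforms D)"
proof (rule bij_betwI[where g = "qform_subst s (-q) (-r) p"])
  have i: "s * p - (-q) * (-r) = 1" using assms by (simp add: algebra_simps)
  show "qform_subst p q r s \<in> qforms D \<rightarrow> qforms D" using qform_subst_in_qforms[OF assms] by auto
  show "qform_subst s (-q) (-r) p \<in> qforms D \<rightarrow> qforms D" using qform_subst_in_qforms[OF i] by auto
  show "qform_subst s (- q) (- r) p (qform_subst p q r s Q) = Q" for Q by (rule qform_subst_inverse[OF assms])
  show "qform_subst p q r s (qform_subst s (- q) (- r) p Q) = Q" for Q using qform_subst_inverse[OF i] by simp
qed

section \<open>Transformation of a single term under a Moebius map\<close>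

context
  fixes p q r s :: int and z :: complex
  assumes det: "p * s - q * r = 1" and z: "Im z > 0"
begin

lemma moebius_denom_nonzero: "of_int r * z + of_int s \<noteq> 0"
proof
  assume eq: "of_int r * z + of_int s = 0"
  then have "Im (of_int r * z + of_int s) = 0" by (simp only: zero_complex.sel)
  then have "r = 0" using z by simp
  with eq det show False by simp
qed

lemma qform_eval_moebius:
  "qform_eval Q ((of_int p * z + of_int q) / (of_int r * z + of_int s)) 1
   = qform_eval (qform_subst p q r s Q) z 1 / (of_int r * z + of_int s)\<^sup>2"
proof -
  obtain a b c where Q: "Q = (a, b, c)" by (cases Q)
  define u v where "u = of_int p * z + of_int q" and "v = of_int r * z + of_int s"
  have v: "v \<noteq> 0" using moebius_denom_nonzero by (simp add: v_def)
  have "qform_eval Q (u / v) 1 = (of_int a * u\<^sup>2 + of_int b * u * v + of_int c * v\<^sup>2) / v\<^sup>2"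
    using v by (simp add: Q power2_eq_square field_simps)
  also have "of_int a * u\<^sup>2 + of_int b * u * v + of_int c * v\<^sup>2 = qform_eval (qform_subst p q r s Q) z 1"
    by (simp add: Q qform_subst_def u_def v_def power2_eq_square algebra_simps)
  finally show ?thesis by (simp add: u_def v_def)
qed

text \<open>At u/v the circle polynomial is the Hermitian form a|u|^2 + b Re(u cnj(v)) + c|v|^2
  divided by |v|^2. The factor is positive, so signs are preserved.\<close>

lemma qform_circle_moebius:
  "qform_circle Q ((of_int p * z + of_int q) / (of_int r * z + of_int s))
   = qform_circle (qform_subst p q r s Q) z / (cmod (of_int r * z + of_int s))\<^sup>2"
proof -
  obtain a b c where Q: "Q = (a, b, c)" by (cases Q)
  define u v where "u = of_int p * z + of_int q" and "v = of_int r * z + of_int s"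
  have v: "v \<noteq> 0" using moebius_denom_nonzero by (simp add: v_def)
  have "qform_circle Q (u / v) = (of_int a * (cmod u)\<^sup>2 + of_int b * Re (u * cnj v) + of_int c * (cmod v)\<^sup>2) / (cmod v)\<^sup>2"
    using v unfolding complex_div_cnj[of u v]
    by (simp add: Q norm_divide norm_mult power_divide power2_eq_square field_simps flip: of_real_power of_real_mult del: times_complex.sel)
  also have "of_int a * (cmod u)\<^sup>2 + of_int b * Re (u * cnj v) + of_int c * (cmod v)\<^sup>2 = qform_circle (qform_subst p q r s Q) z"
    by (simp add: Q qform_subst_def u_def v_def cmod_power2) (simp add: power2_eq_square algebra_simps)
  finally show ?thesis by (simp add: u_def v_def)
qed

lemma Im_moebius:
  "Im ((of_int p * z + of_int q) / (of_int r * z + of_int s)) = Im z / (cmod (of_int r * z + of_int s))\<^sup>2"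
proof -
  have "Im ((of_int p * z + of_int q) / (of_int r * z + of_int s))
      = of_int (p * s - q * r) * Im z / (cmod (of_int r * z + of_int s))\<^sup>2"
    by (simp add: Im_divide cmod_power2 algebra_simps)
  then show ?thesis by (simp add: det)
qed

text \<open>The sign and the argument of \<open>psi\<close> are invariant, so the automorphy factor
  comes entirely from Q(z,1)^(k-1), which has weight -2(k-1).\<close>

lemma F_summand_moebius:
  "(of_int r * z + of_int s) ^ (2 * k - 2) * F_summand k D ((of_int p * z + of_int q) / (of_int r * z + of_int s)) Q
   = F_summand k D z (qform_subst p q r s Q)"
proof -
  define v where "v = of_int r * z + of_int s"
  have v: "v \<noteq> 0" using moebius_denom_nonzero by (simp add: v_def)
  have pow: "v ^ (2 * k - 2) = (v\<^sup>2) ^ (k - 1)" by (simp flip: power_mult add: diff_mult_distrib2)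
  have arg: "of_int D * (Im z / (cmod v)\<^sup>2)\<^sup>2 / (cmod (qform_eval (qform_subst p q r s Q) z 1 / v\<^sup>2))\<^sup>2
     = of_int D * (Im z)\<^sup>2 / (cmod (qform_eval (qform_subst p q r s Q) z 1))\<^sup>2"
    using v by (simp add: norm_divide norm_power power_divide)
  have sg: "sgn (qform_circle (qform_subst p q r s Q) z / (cmod v)\<^sup>2) = sgn (qform_circle (qform_subst p q r s Q) z)"
    using v by (simp add: sgn_divide)
  show ?thesis
    unfolding F_summand_def qform_eval_moebius qform_circle_moebius Im_moebius
    unfolding v_def[symmetric] pow arg sg
    using v by (simp add: power_divide)
qed

end

lemma slash_F_fun:
  assumes g: "g \<in> SL2Z" and z: "z \<in> upper_half_plane" and k: "k > 1"
  shows "slash (F_fun k D) (2 - 2 * int k) g z = F_fun k D z"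
proof -
  define p q r s where "p = g$1$1" and "q = g$1$2" and "r = g$2$1" and "s = g$2$2"
  have det: "p * s - q * r = 1" using g by (simp add: SL2Z_def det_2 p_def q_def r_def s_def)
  have y: "Im z > 0" using z by (simp add: upper_half_plane_def)
  define v where "v = of_int r * z + of_int s"
  define w where "w = (of_int p * z + of_int q) / v"
  have e: "- (2 - 2 * int k) = int (2 * k - 2)" using k by simp
  \<comment> \<open>Pulling out a factor and reindexing are identities of \<open>infsum\<close>
    itself, consistent with its default value 0 on families that are not summable.\<close>
  have "v ^ (2 * k - 2) * (\<Sum>\<^sub>\<infinity>Q\<in>qforms D. F_summand k D w Q) = (\<Sum>\<^sub>\<infinity>Q\<in>qforms D. v ^ (2 * k - 2) * F_summand k D w Q)"
    by (rule infsum_cmult_right' [symmetric])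
  also have "\<dots> = (\<Sum>\<^sub>\<infinity>Q\<in>qforms D. F_summand k D z (qform_subst p q r s Q))"
    unfolding w_def v_def by (simp only: F_summand_moebius[OF det y])
  also have "\<dots> = (\<Sum>\<^sub>\<infinity>Q\<in>qforms D. F_summand k D z Q)"
    by (rule infsum_reindex_bij_betw[OF bij_betw_qform_subst[OF det]])
  finally have "v ^ (2 * k - 2) * F_fun k D w = F_fun k D z" by (simp add: F_fun_def)
  then show ?thesis unfolding slash_def moebius_def e power_int_of_nat
    by (simp add: w_def v_def p_def q_def r_def s_def)
qed

lemma F_fun_periodic:
  assumes "k > 1" "Im z > 0"
  shows "F_fun k D (z + of_int m) = F_fun k D z"
proof -
  define g :: "int^2^2" where "g = vector [vector [1, m], vector [0, 1]]"
  have "g \<in> SL2Z" by (simp add: SL2Z_def det_2 g_def)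
  from slash_F_fun[OF this _ assms(1), of z D] assms(2) show ?thesis
    by (simp add: slash_def moebius_def g_def upper_half_plane_def)
qed

section \<open>Convergence, vertical limits and growth\<close>

text \<open>Finitely many b, finitely many divisors a of the nonzero b^2 - D for each, and c
  determined by both. This yields local finiteness of the geodesics.\<close>

lemma finite_qforms_bounded_middle:
  assumes nsq: "\<not> (\<exists>n::int. D = n\<^sup>2)"
  shows "finite {(a, b, c) \<in> qforms D. \<bar>of_int b\<bar> \<le> (B :: real)}"
proof (rule finite_subset)
  have nz: "b\<^sup>2 - D \<noteq> 0" for b using nsq by auto
  show "finite ((\<lambda>(b, a). (a, b, (b\<^sup>2 - D) div (4 * a))) ` Sigma {- \<lceil>B\<rceil>..\<lceil>B\<rceil>} (\<lambda>b. {a. a dvd b\<^sup>2 - D}))"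
    by (intro finite_imageI finite_SigmaI card_int_divisors_cubed(1) nz) auto
  show "{(a, b, c) \<in> qforms D. \<bar>of_int b\<bar> \<le> B} \<subseteq>
      (\<lambda>(b, a). (a, b, (b\<^sup>2 - D) div (4 * a))) ` Sigma {- \<lceil>B\<rceil>..\<lceil>B\<rceil>} (\<lambda>b. {a. a dvd b\<^sup>2 - D})"
  proof
    fix Q assume "Q \<in> {(a, b, c) \<in> qforms D. \<bar>of_int b\<bar> \<le> B}"
    then obtain a b c where Q: "Q = (a, b, c)" "(a, b, c) \<in> qforms D" "\<bar>of_int b\<bar> \<le> B" by auto
    have a: "a \<noteq> 0" using qforms_fst_nonzero[OF nsq Q(2)] .
    have e: "b\<^sup>2 - D = 4 * a * c" using Q(2) by (auto simp: qforms_def)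
    have "b \<in> {- \<lceil>B\<rceil>..\<lceil>B\<rceil>}" using Q(3) by (auto simp: abs_le_iff) linarith+
    then show "Q \<in> (\<lambda>(b, a). (a, b, (b\<^sup>2 - D) div (4 * a))) ` Sigma {- \<lceil>B\<rceil>..\<lceil>B\<rceil>} (\<lambda>b. {a. a dvd b\<^sup>2 - D})"
      using a by (intro image_eqI[of _ _ "(b, a)"]) (auto simp: Q(1) e)
  qed
qed

lemma continuous_on_qform_circle: "continuous_on S (qform_circle Q)"
  by (cases Q) (auto simp: qform_circle_alt[abs_def] simp del: qform_circle.simps intro!: continuous_intros)

lemma F_summand_summable:
  assumes k: "k > 1" and D: "D > 0" and nsq: "\<not> (\<exists>n::int. D = n\<^sup>2)" and z: "Im z > 0"
  shows "F_summand k D z summable_on qforms D"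
proof (rule abs_summable_summable, rule Infinite_Sum.abs_summable_on_comparison_test')
  show "cmod (F_summand k D z Q) \<le>
     (of_int D * (Im z)\<^sup>2) powr (real k - 1/2) * qform_const D (Im z) \<bar>Re z\<bar> ^ k * qform_weight Q"
    if "Q \<in> qforms D" for Q
    using norm_F_summand_le_weight[OF k that D z order_refl order_refl order_refl] .
  show "(\<lambda>Q. (of_int D * (Im z)\<^sup>2) powr (real k - 1/2) * qform_const D (Im z) \<bar>Re z\<bar> ^ k * qform_weight Q)
      summable_on qforms D"
    by (intro summable_on_cmult_right qform_weight_summable nsq)
qed

section \<open>Signs near a point off the geodesics\<close>

lemma ball_in_strip:
  assumes "w \<in> cball z r"
  shows "Im z - r \<le> Im w" "Im w \<le> Im z + r" "\<bar>Re w\<bar> \<le> \<bar>Re z\<bar> + r"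
  using assms abs_Re_le_cmod[of "z - w"] abs_Im_le_cmod[of "z - w"] by (auto simp: dist_norm)

text \<open>On its geodesic a form has |Q(w,1)| = sqrt(D) Im w, so b is bounded if the geodesic
  meets a given small ball. Only finitely many forms remain to be avoided, and connectedness of the
  ball fixes every sign.\<close>

lemma sgn_qform_circle_locally_constant:
  assumes D: "D > 0" and nsq: "\<not> (\<exists>n::int. D = n\<^sup>2)" and z: "Im z > 0" and E: "z \<notin> exceptional_set D"
  obtains r where "0 < r" "r \<le> Im z / 2"
    "\<And>Q w. Q \<in> qforms D \<Longrightarrow> w \<in> ball z r \<Longrightarrow> qform_circle Q w \<noteq> 0 \<and> sgn (qform_circle Q w) = sgn (qform_circle Q z)"
proof -
  define y X where "y = Im z / 2" and "X = \<bar>Re z\<bar> + Im z / 2"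
  \<comment> \<open>The bound for 1+|b| at a zero of the circle polynomial, where |Q(w,1)| <=
    sqrt(D) * 2 Im z throughout the ball of radius Im z / 2.\<close>
  define B where "B = qform_const D y X * (sqrt (of_int D) * (2 * Im z))"
  define S where "S = {(a, b, c) \<in> qforms D. \<bar>of_int b\<bar> \<le> B}"
  have y: "y > 0" using z by (simp add: y_def)
  have const0: "qform_const D y X \<ge> 0" unfolding qform_const_def X_def using y D z by (intro add_nonneg_nonneg divide_nonneg_nonneg) auto
  have S: "finite S" unfolding S_def by (rule finite_qforms_bounded_middle[OF nsq])
  have in_S: "Q \<in> S" if Q: "Q \<in> qforms D" and w: "w \<in> ball z y" "qform_circle Q w = 0" for Q w
  proof -
    obtain a b c where abc: "Q = (a, b, c)" by (cases Q)
    have w': "w \<in> cball z y" using w by auto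
    have b: "y \<le> Im w" "Im w \<le> 2 * Im z" "\<bar>Re w\<bar> \<le> X" using ball_in_strip[OF w'] z by (auto simp: y_def X_def)
    have "(cmod (qform_eval Q w 1))\<^sup>2 = (sqrt (of_int D) * Im w)\<^sup>2"
      using norm_qform_eval_power2[OF Q, of w] w D by (simp add: power_mult_distrib)
    then have "cmod (qform_eval Q w 1) = sqrt (of_int D) * Im w"
      using b y D by (subst (asm) power2_eq_iff_nonneg) auto
    also have "\<dots> \<le> sqrt (of_int D) * (2 * Im z)" using b D by simp
    finally have "qform_const D y X * cmod (qform_eval Q w 1) \<le> B" unfolding B_def using const0 by (rule mult_left_mono)
    then have "\<bar>of_int b\<bar> \<le> B" using qform_const_bound[OF Q[unfolded abc] D y b(1) b(3)] by (simp only: abc)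
    then show ?thesis using Q by (simp add: S_def abc)
  qed
  have "eventually (\<lambda>w. \<forall>Q\<in>S. qform_circle Q w \<noteq> 0) (nhds z)"
  proof (rule eventually_ball_finite[OF S], rule ballI)
    fix Q assume "Q \<in> S"
    then have "Q \<in> qforms D" by (auto simp: S_def)
    then have "qform_circle Q z \<noteq> 0" using E z by (auto simp: exceptional_set_def geodesic_def upper_half_plane_def)
    moreover have "isCont (qform_circle Q) z"
      using continuous_on_qform_circle[of UNIV Q] by (simp add: continuous_on_eq_continuous_at)
    ultimately show "eventually (\<lambda>w. qform_circle Q w \<noteq> 0) (nhds z)"
      using tendsto_imp_eventually_ne by (metis continuous_at filterlim_at_within_not_equal isCont_def tendsto_at_iff_tendsto_nhds)
  qed
  then obtain e where e: "e > 0" "\<And>w Q. dist w z < e \<Longrightarrow> Q \<in> S \<Longrightarrow> qform_circle Q w \<noteq> 0"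
    unfolding eventually_nhds_metric by blast
  define r where "r = min e y"
  have nz: "qform_circle Q w \<noteq> 0" if "Q \<in> qforms D" "w \<in> ball z r" for Q w
    using in_S[OF that(1), of w] e(2)[of w Q] that(2) by (auto simp: r_def dist_commute)
  have "sgn (qform_circle Q w) = sgn (qform_circle Q z)" if Q: "Q \<in> qforms D" and w: "w \<in> ball z r" for Q w
  proof (rule ccontr)
    assume neq: "sgn (qform_circle Q w) \<noteq> sgn (qform_circle Q z)"
    have r: "r > 0" using e y by (simp add: r_def)
    have conn: "connected (qform_circle Q ` ball z r)"
      by (intro connected_continuous_image continuous_on_qform_circle) auto
    have mem: "qform_circle Q w \<in> qform_circle Q ` ball z r" "qform_circle Q z \<in> qform_circle Q ` ball z r"
      using w r by auto
    have "0 \<in> qform_circle Q ` ball z r"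
      using connected_contains_Icc[OF conn mem] connected_contains_Icc[OF conn mem(2) mem(1)] neq
        nz[OF Q w] nz[OF Q, of z] r by (auto simp: sgn_if split: if_splits)
    then show False using nz[OF Q] by auto
  qed
  note const = this
  show ?thesis
  proof (rule that)
    show "0 < r" "r \<le> Im z / 2" using e y by (auto simp: r_def y_def)
  qed (intro conjI nz const; assumption)+
qed

section \<open>Two-sided limits along vertical lines\<close>

definition F_branch :: "nat \<Rightarrow> int \<Rightarrow> qform \<Rightarrow> complex \<Rightarrow> complex" where
  "F_branch k D Q z = qform_eval Q z 1 ^ (k - 1) *
     of_real (psi k (of_int D * (Im z)\<^sup>2 / (cmod (qform_eval Q z 1))\<^sup>2))"

lemma isCont_qform_eval: "isCont (\<lambda>z. qform_eval Q z 1) z"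
  by (cases Q) (auto intro!: continuous_intros)

text \<open>With the sign removed, a summand is continuous even across its geodesic: there the
  argument of \<open>psi\<close> reaches 1, and \<open>psi\<close> is continuous up to that
  endpoint. All jumps come from \<open>sgn\<close>.\<close>

lemma isCont_F_branch:
  assumes k: "k > 1" and Q: "Q \<in> qforms D" and D: "D > 0" and z: "Im z > 0"
  shows "isCont (F_branch k D Q) z"
proof -
  define v where "v = (\<lambda>z. of_int D * (Im z)\<^sup>2 / (cmod (qform_eval Q z 1))\<^sup>2)"
  have op: "open {z. Im z > 0}" by (simp add: open_halfspace_Im_gt)
  have cv: "continuous_on {z. Im z > 0} v" unfolding v_def
    using norm_qform_eval_ge(4)[OF Q D]
    by (intro continuous_intros continuous_at_imp_continuous_on ballI isCont_qform_eval) (auto intro: continuous_intros isCont_qform_eval)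
  have "continuous_on {z. Im z > 0} (\<lambda>z. psi k (v z))"
    by (rule continuous_on_compose2[OF continuous_on_psi[OF k] cv])
      (use psi_argument_in_unit_interval[OF Q D] in \<open>fastforce simp: v_def\<close>)
  then have "isCont (\<lambda>z. psi k (v z)) z" using z op by (simp add: continuous_on_eq_continuous_at)
  then show ?thesis unfolding F_branch_def[abs_def] v_def
    by (intro continuous_intros isCont_qform_eval)
qed

lemma F_summand_F_branch: "F_summand k D z Q = of_real (sgn (qform_circle Q z)) * F_branch k D Q z"
  by (simp add: F_summand_def F_branch_def)

lemma qform_circle_vertical:
  "qform_circle (a, b, c) (z + \<i> * of_real h) = qform_circle (a, b, c) z + of_int a * h * (2 * Im z + h)"
  by (simp only: qform_circle_alt) (simp add: power2_eq_square algebra_simps)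

text \<open>A nonsquare discriminant forces \<open>a \<noteq> 0\<close>, so the circle polynomial changes sign transversally
  along vertical lines, and the jumps on the two sides cancel.\<close>

lemma F_summand_vertical_limit:
  assumes k: "k > 1" and Q: "Q \<in> qforms D" and D: "D > 0" and nsq: "\<not> (\<exists>n::int. D = n\<^sup>2)" and z: "Im z > 0"
  shows "((\<lambda>h. F_summand k D (z + \<i> * of_real h) Q + F_summand k D (z - \<i> * of_real h) Q)
    \<longlongrightarrow> 2 * F_summand k D z Q) (at_right 0)"
proof -
  obtain a b c where abc: "Q = (a, b, c)" by (cases Q)
  have a: "a \<noteq> 0" using qforms_fst_nonzero[OF nsq] Q abc by blast
  have F: "((\<lambda>h. F_branch k D Q (z + \<i> * of_real h)) \<longlongrightarrow> F_branch k D Q z) (at_right (0::real))"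
    "((\<lambda>h. F_branch k D Q (z - \<i> * of_real h)) \<longlongrightarrow> F_branch k D Q z) (at_right (0::real))"
    by (rule isCont_tendsto_compose[OF isCont_F_branch[OF k Q D z]],
        (auto intro!: tendsto_eq_intros)[1])+
  \<comment> \<open>The signs just above and just below \<open>z\<close>. On the geodesic they are
    opposite, elsewhere both equal the sign at \<open>z\<close>; in each case their sum is twice
    that sign, with sgn 0 = 0.\<close>
  define s t where "s = (if qform_circle Q z = 0 then sgn (of_int a) else sgn (qform_circle Q z))"
    and "t = (if qform_circle Q z = 0 then - sgn (of_int a) else sgn (qform_circle Q z))"
  have pos: "eventually (\<lambda>h. 0 < h \<and> h < Im z) (at_right (0::real))"
    using eventually_at_right_real[OF z] by eventually_elim auto
  have c1: "((\<lambda>h. qform_circle Q (z + \<i> * of_real h)) \<longlongrightarrow> qform_circle Q z) (at_right (0::real))"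
    unfolding abc qform_circle_vertical by (auto intro!: tendsto_eq_intros simp del: qform_circle.simps)
  have vert': "qform_circle (a, b, c) (z - \<i> * of_real h) = qform_circle (a, b, c) z - of_int a * h * (2 * Im z - h)" for h
    using qform_circle_vertical[of a b c z "- h"] by simp
  have c2: "((\<lambda>h. qform_circle Q (z - \<i> * of_real h)) \<longlongrightarrow> qform_circle Q z) (at_right (0::real))"
    unfolding abc vert' by (auto intro!: tendsto_eq_intros simp del: qform_circle.simps)
  have ev: "eventually (\<lambda>h. sgn (qform_circle Q (z + \<i> * of_real h)) = s \<and> sgn (qform_circle Q (z - \<i> * of_real h)) = t) (at_right (0::real))"
  proof (cases "qform_circle Q z = 0")
    case True
    from pos show ?thesis
    proof eventually_elim
      case (elim h)
      have "2 * Im z - h > 0" "2 * Im z + h > 0" using elim z by auto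
      then show ?case using elim True unfolding abc qform_circle_vertical vert' s_def t_def
        by (simp add: sgn_mult)
    qed
  next
    case False
    then consider "qform_circle Q z > 0" | "qform_circle Q z < 0" by linarith
    then show ?thesis
    proof cases
      case 1
      from order_tendstoD(1)[OF c1 1] order_tendstoD(1)[OF c2 1] show ?thesis
        by eventually_elim (use 1 in \<open>auto simp: s_def t_def\<close>)
    next
      case 2
      from order_tendstoD(2)[OF c1 2] order_tendstoD(2)[OF c2 2] show ?thesis
        by eventually_elim (use 2 in \<open>auto simp: s_def t_def\<close>)
    qed
  qed
  have st: "s + t = 2 * sgn (qform_circle Q z)" by (simp add: s_def t_def)
  have "((\<lambda>h. of_real s * F_branch k D Q (z + \<i> * of_real h) + of_real t * F_branch k D Q (z - \<i> * of_real h))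
     \<longlongrightarrow> of_real s * F_branch k D Q z + of_real t * F_branch k D Q z) (at_right 0)"
    by (intro tendsto_intros F)
  also have "of_real s * F_branch k D Q z + of_real t * F_branch k D Q z = of_real (s + t) * F_branch k D Q z"
    by (simp add: algebra_simps)
  also have "\<dots> = 2 * F_summand k D z Q" unfolding st F_summand_F_branch by simp
  finally show ?thesis
  proof (rule Lim_transform_eventually)
    show "eventually (\<lambda>h. of_real s * F_branch k D Q (z + \<i> * of_real h) + of_real t * F_branch k D Q (z - \<i> * of_real h) =
      F_summand k D (z + \<i> * of_real h) Q + F_summand k D (z - \<i> * of_real h) Q) (at_right 0)"
      using ev by eventually_elim (simp add: F_summand_F_branch)
  qed
qed

text \<open>For small h all points z + ih and z - ih lie in one compact segment, so the series
  converges uniformly in h and the limit may be taken termwise.\<close>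

lemma F_fun_vertical_limit:
  assumes k: "k > 1" and D: "D > 0" and nsq: "\<not> (\<exists>n::int. D = n\<^sup>2)" and z: "Im z > 0"
  shows "((\<lambda>h. F_fun k D (z + \<i> * of_real h) + F_fun k D (z - \<i> * of_real h)) \<longlongrightarrow> 2 * F_fun k D z) (at_right 0)"
proof -
  define y where "y = Im z / 2"
  have y: "y > 0" using z by (simp add: y_def)
  define G where "G h Q = F_summand k D (z + \<i> * of_real h) Q + F_summand k D (z - \<i> * of_real h) Q" for h Q
  \<comment> \<open>For |h| < y = Im z / 2 the heights lie between y and 3y.\<close>
  define C where "C = (of_int D * (3 * y)\<^sup>2) powr (real k - 1/2) * qform_const D y \<bar>Re z\<bar> ^ k"
  have bd: "cmod (F_summand k D (z + \<i> * of_real h) Q) \<le> C * qform_weight Q" if "\<bar>h\<bar> < y" "Q \<in> qforms D" for h Q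
    unfolding C_def using that y by (intro norm_F_summand_le_weight k D) (auto simp: y_def)
  have "uniform_limit {0<..<y} (\<lambda>S h. \<Sum>Q\<in>S. G h Q) (\<lambda>h. \<Sum>\<^sub>\<infinity>Q\<in>qforms D. G h Q) (finite_subsets_at_top (qforms D))"
  proof (rule Weierstrass_m_test_general)
    show "cmod (G h Q) \<le> 2 * C * qform_weight Q" if "Q \<in> qforms D" "h \<in> {0<..<y}" for h Q
      using bd[of h Q] bd[of "- h" Q] that norm_triangle_ineq[of "F_summand k D (z + \<i> * of_real h) Q" "F_summand k D (z - \<i> * of_real h) Q"]
      unfolding G_def by auto
    show "(\<lambda>Q. 2 * C * qform_weight Q) summable_on qforms D"
      by (intro summable_on_cmult_right qform_weight_summable nsq)
  qed
  note ulim = this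
  have "((\<lambda>h. \<Sum>\<^sub>\<infinity>Q\<in>qforms D. G h Q) \<longlongrightarrow> (\<Sum>\<^sub>\<infinity>Q\<in>qforms D. 2 * F_summand k D z Q)) (at_right 0)"
  proof (rule swap_uniform_limit'[OF _ _ ulim])
    show "eventually (\<lambda>S. ((\<lambda>h. \<Sum>Q\<in>S. G h Q) \<longlongrightarrow> (\<Sum>Q\<in>S. 2 * F_summand k D z Q)) (at_right 0)) (finite_subsets_at_top (qforms D))"
      unfolding G_def
      by (rule eventually_finite_subsets_at_top_weakI, intro tendsto_sum F_summand_vertical_limit k D nsq z) auto
    show "((\<lambda>S. \<Sum>Q\<in>S. 2 * F_summand k D z Q) \<longlongrightarrow> (\<Sum>\<^sub>\<infinity>Q\<in>qforms D. 2 * F_summand k D z Q)) (finite_subsets_at_top (qforms D))"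
      using has_sum_infsum[OF summable_on_cmult_right[OF F_summand_summable[OF k D nsq z]], of 2]
      by (simp add: has_sum_def)
    show "eventually (\<lambda>h. h \<in> {0<..<y}) (at_right 0)" using eventually_at_right_real[OF y] .
  qed auto
  define c where "c = complex_of_real (of_int D powr (1/2 - real k) / (real ((2 * k - 2) choose (k - 1)) * pi))"
  have "((\<lambda>h. c * (\<Sum>\<^sub>\<infinity>Q\<in>qforms D. G h Q)) \<longlongrightarrow> c * (\<Sum>\<^sub>\<infinity>Q\<in>qforms D. 2 * F_summand k D z Q)) (at_right 0)"
    by (intro tendsto_intros) fact
  also have "c * (\<Sum>\<^sub>\<infinity>Q\<in>qforms D. 2 * F_summand k D z Q) = 2 * F_fun k D z"
    by (simp add: infsum_cmult_right' F_fun_def c_def)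
  finally show ?thesis
  proof (rule Lim_transform_eventually)
    show "eventually (\<lambda>h. c * (\<Sum>\<^sub>\<infinity>Q\<in>qforms D. G h Q) =
        F_fun k D (z + \<i> * of_real h) + F_fun k D (z - \<i> * of_real h)) (at_right 0)"
      using eventually_at_right_real[OF y]
    proof eventually_elim
      case (elim h)
      have "Im (z + \<i> * of_real h) > 0" "Im (z - \<i> * of_real h) > 0" using elim z by (auto simp: y_def)
      then have "(\<Sum>\<^sub>\<infinity>Q\<in>qforms D. G h Q) = (\<Sum>\<^sub>\<infinity>Q\<in>qforms D. F_summand k D (z + \<i> * of_real h) Q)
          + (\<Sum>\<^sub>\<infinity>Q\<in>qforms D. F_summand k D (z - \<i> * of_real h) Q)"
        unfolding G_def by (intro infsum_add F_summand_summable k D nsq)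
      then show ?case by (simp only: F_fun_def c_def distrib_left)
    qed
  qed
qed

text \<open>On |x| <= 1, y >= 1 the constant \<open>qform_const D 1 1\<close> is uniform, so the
  growth comes only from (D y^2)^(k-1/2), which is y^(2k-1) up to a constant. Integer translations
  bring every point into this strip.\<close>

lemma F_fun_growth:
  assumes k: "k > 1" and D: "D > 0" and nsq: "\<not> (\<exists>n::int. D = n\<^sup>2)"
  shows "\<exists>C. \<forall>z. Im z \<ge> 1 \<longrightarrow> cmod (F_fun k D z) \<le> C * Im z ^ (2 * k - 1)"
proof -
  define W where "W = (\<Sum>\<^sub>\<infinity>Q\<in>qforms D. qform_weight Q)"
  define c where "c = complex_of_real (of_int D powr (1/2 - real k) / (real ((2 * k - 2) choose (k - 1)) * pi))"
  define C where "C = cmod c * (of_int D powr (real k - 1/2) * qform_const D 1 1 ^ k * W)"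
  have strip: "cmod (F_fun k D z) \<le> C * Im z ^ (2 * k - 1)" if z: "Im z \<ge> 1" "\<bar>Re z\<bar> \<le> 1" for z
  proof -
    define M where "M = (of_int D * (Im z)\<^sup>2) powr (real k - 1/2) * qform_const D 1 1 ^ k"
    have M: "cmod (F_summand k D z Q) \<le> M * qform_weight Q" if "Q \<in> qforms D" for Q
      using norm_F_summand_le_weight[OF k that D _ z order_refl] by (simp add: M_def)
    have sM: "(\<lambda>Q. M * qform_weight Q) summable_on qforms D" by (intro summable_on_cmult_right qform_weight_summable nsq)
    have "cmod (\<Sum>\<^sub>\<infinity>Q\<in>qforms D. F_summand k D z Q) \<le> (\<Sum>\<^sub>\<infinity>Q\<in>qforms D. M * qform_weight Q)"
      by (rule norm_infsum_le[OF has_sum_infsum[OF F_summand_summable] has_sum_infsum[OF sM] M]) (use k D nsq z in auto)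
    also have "\<dots> = M * W" by (simp add: W_def infsum_cmult_right')
    finally have "cmod (F_fun k D z) \<le> cmod c * (M * W)"
      unfolding F_fun_def c_def[symmetric] norm_mult by (rule mult_left_mono) simp
    also have "(of_int D * (Im z)\<^sup>2) powr (real k - 1/2) = of_int D powr (real k - 1/2) * Im z ^ (2 * k - 1)"
    proof -
      have "((Im z)\<^sup>2) powr (real k - 1/2) = (Im z powr 2) powr (real k - 1/2)" using z by simp
      also have "\<dots> = Im z powr real (2 * k - 1)" using k by (subst powr_powr) (auto simp: of_nat_diff)
      also have "\<dots> = Im z ^ (2 * k - 1)" using z by (intro powr_realpow) auto
      finally show ?thesis using D by (simp add: powr_mult)
    qed
    then have "cmod c * (M * W) = C * Im z ^ (2 * k - 1)" by (simp add: M_def C_def)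
    finally show ?thesis by simp
  qed
  have "cmod (F_fun k D z) \<le> C * Im z ^ (2 * k - 1)" if z: "Im z \<ge> 1" for z
  proof -
    define w where "w = z + of_int (- \<lfloor>Re z\<rfloor>)"
    have "\<bar>Re w\<bar> \<le> 1" "Im w = Im z" by (auto simp: w_def abs_le_iff) linarith+
    with strip[of w] z F_fun_periodic[OF k, of z D "- \<lfloor>Re z\<rfloor>"] show ?thesis by (simp only: w_def)
  qed
  then show ?thesis by blast
qed

section \<open>Local harmonicity\<close>

text \<open>The quotient rule gives numerator 2iy(az + b/2) + q with q the circle polynomial, and
  this is exactly Q(z,1). The holomorphic derivative is left existential because only the other one
  has to be known.\<close>

lemma wirtinger_normalized_circle:
  assumes z: "Im z > 0"
  shows "\<exists>p. has_wirtinger_derivatives (\<lambda>z. of_real (qform_circle Q z / Im z)) p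
    (qform_eval Q z 1 / (2 * \<i> * of_real ((Im z)\<^sup>2))) z"
proof -
  obtain a b c where Q: "Q = (a, b, c)" by (cases Q)
  have id: "has_wirtinger_derivatives (\<lambda>z. z) 1 0 z"
    using has_wirtinger_derivatives_holomorphic[of "\<lambda>z. z" 1 z] by simp
  note cj = has_wirtinger_derivatives_cnj[OF id, simplified]
  have "has_wirtinger_derivatives (\<lambda>z. of_int a * (z * cnj z) + of_int b / 2 * (z + cnj z) + of_int c)
    (of_int a * (1 * cnj z + z * 0) + of_int b / 2 * (1 + 0) + 0) (of_int a * (0 * cnj z + z * 1) + of_int b / 2 * (0 + 1) + 0) z"
    by (intro has_wirtinger_derivatives_add has_wirtinger_derivatives_cmult has_wirtinger_derivatives_mult
        has_wirtinger_derivatives_const id cj)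
  moreover have "of_int a * (w * cnj w) + of_int b / 2 * (w + cnj w) + of_int c = of_real (qform_circle Q w)" for w
    by (simp add: Q complex_norm_square complex_add_cnj del: of_real_power)
  ultimately have circ: "has_wirtinger_derivatives (\<lambda>z. of_real (qform_circle Q z))
      (of_int a * cnj z + of_int b / 2) (of_int a * z + of_int b / 2) z" by simp
  have "has_wirtinger_derivatives (\<lambda>z. (1 / (2 * \<i>)) * (z - cnj z)) ((1 / (2 * \<i>)) * (1 - 0)) ((1 / (2 * \<i>)) * (0 - 1)) z"
    by (intro has_wirtinger_derivatives_cmult has_wirtinger_derivatives_diff id cj)
  moreover have "(1 / (2 * \<i>)) * (w - cnj w) = of_real (Im w)" for w
    by (simp add: complex_eq_iff)
  ultimately have im: "has_wirtinger_derivatives (\<lambda>z. of_real (Im z)) (1 / (2 * \<i>)) (- 1 / (2 * \<i>)) z" by simp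
  have "(inverse has_real_derivative (- inverse (Im z) * inverse (Im z))) (at (Im z))"
    using z DERIV_inverse[of "Im z" UNIV] by (simp add: power2_eq_square)
  note inv = has_wirtinger_derivatives_of_real_compose[where t = Im, OF this im]
  note W = has_wirtinger_derivatives_mult[OF circ inv]
  have y: "complex_of_real (Im z) \<noteq> 0" using z by simp
  have "2 * \<i> * of_real (Im z) * (of_int a * z + of_int b / 2) + of_real (qform_circle Q z) = qform_eval Q z 1"
  proof -
    have iy: "2 * \<i> * of_real (Im z) = z - cnj z" by (simp add: complex_diff_cnj)
    have circ': "of_real (qform_circle Q z) = of_int a * (z * cnj z) + of_int b / 2 * (z + cnj z) + of_int c"
      by (simp add: Q complex_norm_square complex_add_cnj del: of_real_power)
    show ?thesis unfolding iy circ' by (simp add: Q power2_eq_square field_simps)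
  qed
  then have eval: "qform_eval Q z 1 = 2 * \<i> * of_real (Im z) * (of_int a * z + of_int b / 2) + of_real (qform_circle Q z)" by simp
  have "(of_int a * z + of_int b / 2) * of_real (inverse (Im z)) +
     of_real (qform_circle Q z) * (of_real (- inverse (Im z) * inverse (Im z)) * (- 1 / (2 * \<i>)))
     = qform_eval Q z 1 / (2 * \<i> * of_real ((Im z)\<^sup>2))"
    unfolding eval using y by (simp add: field_simps power2_eq_square)
  note W' = W[unfolded this]
  show ?thesis
    by (rule exI, rule has_wirtinger_derivatives_cong[OF W' open_UNIV UNIV_I]) (simp add: divide_inverse)
qed

text \<open>With \<open>v = D / (D + s\<^sup>2)\<close> the square roots in the integrand of \<open>\<psi>\<close> become rational in \<open>s\<close>.\<close>

lemma psi_rational_derivative: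
  assumes k: "k > 1" and D: "D > 0" and s: "s \<noteq> 0"
  shows "((\<lambda>s. sgn \<sigma> * psi k (D / (D + s\<^sup>2))) has_real_derivative
    (- (sgn \<sigma> * sgn s) * sqrt D ^ (2 * k - 1) / (D + s\<^sup>2) ^ k)) (at s)"
proof -
  define A B where "A = sqrt D" and "B = sqrt (D + s\<^sup>2)"
  have pos: "D + s\<^sup>2 > 0" using D by (simp add: add_pos_nonneg)
  have A: "A > 0" "D = A\<^sup>2" using D by (auto simp: A_def)
  have B: "B > 0" "D + s\<^sup>2 = B\<^sup>2" using pos by (auto simp: B_def)
  define v where "v = D / (D + s\<^sup>2)"
  have v: "0 < v" "v < 1" using D s pos by (auto simp: v_def)
  have "v = (A / B)\<^sup>2" unfolding v_def B(2) by (simp add: power_divide A(2)[symmetric])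
  then have "v powr (real k - 3/2) = ((A / B) powr 2) powr (real k - 3/2)"
    using A(1) B(1) by simp
  also have "\<dots> = (A / B) powr real (2 * k - 3)" using k by (subst powr_powr) (auto simp: of_nat_diff)
  also have "\<dots> = (A / B) ^ (2 * k - 3)" using A(1) B(1) by (intro powr_realpow) auto
  finally have v1: "v powr (real k - 3/2) = (A / B) ^ (2 * k - 3)" .
  have "1 - v = s\<^sup>2 / B\<^sup>2" using pos unfolding v_def B(2)[symmetric] by (simp add: field_simps)
  then have "(1 - v) powr (-1/2) = inverse (sqrt (s\<^sup>2 / B\<^sup>2))"
    by (simp add: powr_minus powr_half_sqrt)
  also have "\<dots> = B / \<bar>s\<bar>" using B(1) by (simp add: real_sqrt_divide)
  finally have v2: "(1 - v) powr (-1/2) = B / \<bar>s\<bar>" .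
  have dv: "((\<lambda>s. D / (D + s\<^sup>2)) has_real_derivative (- (D * (2 * s)) / (B\<^sup>2)\<^sup>2)) (at s)"
    using pos B by (auto intro!: derivative_eq_intros simp: power2_eq_square)
  have "((\<lambda>s. sgn \<sigma> * psi k (D / (D + s\<^sup>2))) has_real_derivative
     (sgn \<sigma> * (1/2 * ((A / B) ^ (2 * k - 3) * (B / \<bar>s\<bar>)) * (- (D * (2 * s)) / (B\<^sup>2)\<^sup>2)))) (at s)"
    by (rule DERIV_cmult[OF DERIV_chain2[OF psi_has_real_derivative[OF k v, unfolded v1 v2, unfolded v_def] dv]])
  \<comment> \<open>The factor s of the inner derivative cancels |s| up to \<open>sgn s\<close>; as
    k >= 2, the exponent 2k-3 is not truncated.\<close>
  also have "sgn \<sigma> * (1/2 * ((A / B) ^ (2 * k - 3) * (B / \<bar>s\<bar>)) * (- (D * (2 * s)) / (B\<^sup>2)\<^sup>2))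
     = - (sgn \<sigma> * sgn s) * A ^ (2 * k - 1) / (B\<^sup>2) ^ k"
  proof -
    have "2 * k - 1 = (2 * k - 3) + 2" "B ^ (2 * k) = B ^ ((2 * k - 3) + 3)" using k by auto
    then have e: "A ^ (2 * k - 1) = A ^ (2 * k - 3) * A\<^sup>2" "(B\<^sup>2) ^ k = B ^ (2 * k - 3) * B ^ 3"
      by (simp_all only: power_add power_mult [symmetric])
    have "s / \<bar>s\<bar> = sgn s" using s by (simp add: sgn_if)
    then show ?thesis unfolding e power_divide A(2) using B(1) s
      by (auto simp: field_simps power2_eq_square power3_eq_cube sgn_if)
  qed
  finally show ?thesis by (simp add: A_def B(2))
qed

text \<open>Freezing the sign on \<open>U\<close> makes the term Q^(k-1) g(t) with t = q/y and D +
  t^2 = |Q|^2/y^2. The exponent k-1 makes the holomorphic factors cancel: Q^(k-1) Q / |Q|^(2k) is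
  the conjugate of Q^(-k).\<close>

lemma F_summand_wirtinger:
  assumes k: "k > 1" and Q: "Q \<in> qforms D" and D: "D > 0" and U: "open U" "z \<in> U"
    and y: "\<And>w. w \<in> U \<Longrightarrow> Im w > 0"
    and const: "\<And>w. w \<in> U \<Longrightarrow> sgn (qform_circle Q w) = sgn \<sigma>" and nz: "\<sigma> \<noteq> 0"
  shows "\<exists>p. has_wirtinger_derivatives (\<lambda>z. F_summand k D z Q) p
    (\<i> / 2 * of_real (sqrt (of_int D) ^ (2 * k - 1)) * of_real (Im z) ^ (2 * k - 2) * cnj (inverse (qform_eval Q z 1 ^ k))) z"
proof -
  define t where "t w = qform_circle Q w / Im w" for w
  define d where "d = real_of_int D"
  define g where "g s = sgn \<sigma> * psi k (d / (d + s\<^sup>2))" for s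
  define Y where "Y = complex_of_real (Im z)"
  define q where "q = qform_eval Q z 1"
  have d: "d > 0" using D by (simp add: d_def)
  have yz: "Im z > 0" by (rule y[OF U(2)])
  have Y: "Y \<noteq> 0" using yz by (simp add: Y_def)
  have qz: "q \<noteq> 0" unfolding q_def by (rule norm_qform_eval_ge[OF Q D yz])
  have tz2: "sgn (t z) = sgn \<sigma>" using const[OF U(2)] yz by (simp add: t_def sgn_divide)
  have tz1: "t z \<noteq> 0"
  proof
    assume "t z = 0"
    with tz2 nz show False by (simp add: sgn_zero_iff)
  qed
  note tz = tz1 tz2
  have "sgn \<sigma> * sgn \<sigma> = 1" using nz by (simp add: sgn_if)
  then have g': "(g has_real_derivative (- (sqrt d ^ (2 * k - 1)) / (d + (t z)\<^sup>2) ^ k)) (at (t z))"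
    using psi_rational_derivative[OF k d tz(1), of \<sigma>] by (simp add: g_def[abs_def] tz(2))
  obtain p where p: "has_wirtinger_derivatives (\<lambda>z. of_real (t z)) p (q / (2 * \<i> * Y\<^sup>2)) z"
    using wirtinger_normalized_circle[OF yz, of Q] by (auto simp: t_def q_def Y_def)
  note W1 = has_wirtinger_derivatives_of_real_compose[where t = t, OF g' p]
  have "\<exists>q'. ((\<lambda>z. qform_eval Q z 1 ^ (k - 1)) has_field_derivative q') (at z)"
    by (cases Q) (auto intro!: exI derivative_eq_intros)
  then obtain q' where "has_wirtinger_derivatives (\<lambda>z. qform_eval Q z 1 ^ (k - 1)) q' 0 z"
    by (auto simp: has_wirtinger_derivatives_holomorphic)
  note W2 = has_wirtinger_derivatives_mult[OF this W1]
  have eq: "qform_eval Q w 1 ^ (k - 1) * of_real (g (t w)) = F_summand k D w Q" if w: "w \<in> U" for w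
  proof -
    have "d * (Im w)\<^sup>2 / (cmod (qform_eval Q w 1))\<^sup>2 = d / (d + (t w)\<^sup>2)"
      unfolding norm_qform_eval_power2[OF Q] t_def d_def using y[OF w] D
      by (simp add: field_simps add_pos_nonneg power2_eq_square)
    then show ?thesis by (simp add: F_summand_def g_def const[OF w] d_def)
  qed
  have N: "d + (t z)\<^sup>2 = (cmod q)\<^sup>2 / (Im z)\<^sup>2"
    unfolding q_def norm_qform_eval_power2[OF Q] t_def d_def using yz by (simp add: field_simps)
  have "complex_of_real ((d + (t z)\<^sup>2) ^ k) = (q * cnj q / Y\<^sup>2) ^ k"
    unfolding N by (simp add: Y_def flip: complex_norm_square)
  then have "0 * of_real (g (t z)) + q ^ (k - 1) * (of_real (- (sqrt d ^ (2 * k - 1)) / (d + (t z)\<^sup>2) ^ k) * (q / (2 * \<i> * Y\<^sup>2)))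
     = q ^ (k - 1) * (- of_real (sqrt d ^ (2 * k - 1)) / (q * cnj q / Y\<^sup>2) ^ k * (q / (2 * \<i> * Y\<^sup>2)))"
    by (simp only: of_real_divide of_real_minus mult_zero_left add_0_left)
  also have "\<dots> = \<i> / 2 * of_real (sqrt d ^ (2 * k - 1)) * Y ^ (2 * k - 2) * cnj (inverse (q ^ k))"
  proof -
    obtain m where m: "k = Suc m" using k by (cases k) auto
    have e: "2 * k - 2 = 2 * m" using m by auto
    define Y2 where "Y2 = Y\<^sup>2"
    have Y2: "Y2 \<noteq> 0" "Y ^ (2 * m) = Y2 ^ m" using Y by (auto simp: Y2_def power_mult)
    show ?thesis unfolding e Y2 Y2_def[symmetric] unfolding m using qz Y2(1)
      by (simp add: field_simps)
  qed
  finally have rhs: "0 * of_real (g (t z)) + q ^ (k - 1) * (of_real (- (sqrt d ^ (2 * k - 1)) / (d + (t z)\<^sup>2) ^ k) * (q / (2 * \<i> * Y\<^sup>2)))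
      = \<i> / 2 * of_real (sqrt d ^ (2 * k - 1)) * Y ^ (2 * k - 2) * cnj (inverse (q ^ k))" .
  show ?thesis unfolding q_def[symmetric] Y_def[symmetric] d_def[symmetric] rhs[symmetric]
    by (rule exI, rule has_wirtinger_derivatives_cong[OF W2[folded q_def] U eq])
qed

section \<open>Eichler integrals with separated variables\<close>

lemma has_wirtinger_derivatives_power:
  assumes "has_wirtinger_derivatives F p q z"
  shows "has_wirtinger_derivatives (\<lambda>z. F z ^ n) (of_nat n * F z ^ (n - 1) * p) (of_nat n * F z ^ (n - 1) * q) z"
  using has_derivative_power[OF assms[unfolded has_wirtinger_derivatives_def], of n]
  by (simp add: has_wirtinger_derivatives_def algebra_simps)

text \<open>The \<open>z\<close>-derivative of the binomial theorem. With \<open>c\<close> the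
  negative conjugate of \<open>z\<close> it evaluates the mixed derivative of an Eichler
  integral.\<close>

lemma binomial_derivative_sum:
  fixes z c :: complex
  shows "(\<Sum>j\<le>n. of_nat (n choose j) * (of_nat j * z ^ (j - 1)) * c ^ (n - j)) = of_nat n * (z + c) ^ (n - 1)"
proof (rule DERIV_unique)
  show "((\<lambda>x. \<Sum>j\<le>n. of_nat (n choose j) * x ^ j * c ^ (n - j)) has_field_derivative
      (\<Sum>j\<le>n. of_nat (n choose j) * (of_nat j * z ^ (j - 1)) * c ^ (n - j))) (at z)"
    by (intro DERIV_sum) (auto intro!: derivative_eq_intros)
  show "((\<lambda>x. \<Sum>j\<le>n. of_nat (n choose j) * x ^ j * c ^ (n - j)) has_field_derivative
      of_nat n * (z + c) ^ (n - 1)) (at z)"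
    unfolding binomial_ring [symmetric] by (auto intro!: derivative_eq_intros)
qed

lemma has_sum_finite_sum:
  fixes f :: "'i \<Rightarrow> 'a \<Rightarrow> 'b :: topological_comm_monoid_add"
  assumes "\<And>j. j \<in> J \<Longrightarrow> (f j has_sum S j) A"
  shows "((\<lambda>x. \<Sum>j\<in>J. f j x) has_sum (\<Sum>j\<in>J. S j)) A"
  using assms by (induction J rule: infinite_finite_induct) (auto intro: has_sum_add has_sum_0)

text \<open>The sum over \<open>j\<close> is a nonholomorphic Eichler integral of \<open>f\<close>, with the kernel \<open>(\<tau> - \<omega>\<^sup>*)\<^sup>n\<close> expanded
  so that \<open>\<tau>\<close> and the conjugated integration variable separate.\<close>

lemma hyperbolic_laplacian_Eichler_integral:
  fixes F H f :: "complex \<Rightarrow> complex" and A :: "nat \<Rightarrow> complex \<Rightarrow> complex"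
  assumes U: "open U" "z \<in> U" and n: "n > 0"
    and H: "H holomorphic_on U" and f: "f holomorphic_on U"
    and A: "\<And>j w. w \<in> U \<Longrightarrow> (A j has_field_derivative (- w) ^ (n - j) * f w) (at w)"
    and F: "\<And>w. w \<in> U \<Longrightarrow> F w = H w + \<kappa> * (\<Sum>j\<le>n. of_nat (n choose j) * w ^ j * cnj (A j w))"
  shows "hyperbolic_laplacian (- int n) F z = 0"
proof -
  define a where "a j w = of_nat (n choose j) * w ^ j" for j and w :: complex
  define a' where "a' j w = of_nat (n choose j) * (of_nat j * w ^ (j - 1))" for j and w :: complex
  define g where "g j w = (- w) ^ (n - j) * f w" for j w
  have a: "has_wirtinger_derivatives (a j) (a' j w) 0 w" for j w
    unfolding has_wirtinger_derivatives_holomorphic [symmetric] a_def a'_def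
    by (auto intro!: derivative_eq_intros)
  have Ac: "has_wirtinger_derivatives (\<lambda>w. cnj (A j w)) 0 (cnj (g j w)) w" if "w \<in> U" for j w
    using has_wirtinger_derivatives_cnj[OF A[OF that, of j, unfolded has_wirtinger_derivatives_holomorphic]]
    by (simp add: g_def)
  have hH: "has_wirtinger_derivatives H (deriv H w) 0 w" if "w \<in> U" for w
    unfolding has_wirtinger_derivatives_holomorphic [symmetric] by (rule holomorphic_derivI[OF H U(1) that])
  have aA: "has_wirtinger_derivatives (\<lambda>w. a j w * cnj (A j w)) (a' j w * cnj (A j w)) (a j w * cnj (g j w)) w"
    if "w \<in> U" for j w
    using has_wirtinger_derivatives_mult[OF a Ac[OF that], of j j] by simp
  define P where "P w = deriv H w + \<kappa> * (\<Sum>j\<le>n. a' j w * cnj (A j w))" for w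
  define R where "R w = 0 + \<kappa> * (\<Sum>j\<le>n. a j w * cnj (g j w))" for w
  have F1: "has_wirtinger_derivatives F (P w) (R w) w" if w: "w \<in> U" for w
  proof (rule has_wirtinger_derivatives_cong[OF _ U(1) w])
    show "has_wirtinger_derivatives (\<lambda>w. H w + \<kappa> * (\<Sum>j\<le>n. a j w * cnj (A j w))) (P w) (R w) w"
      unfolding P_def R_def
      by (intro has_wirtinger_derivatives_add has_wirtinger_derivatives_cmult has_wirtinger_derivatives_sum hH aA w)
  qed (simp add: F a_def)
  \<comment> \<open>The mixed derivative. It is reached from \<open>P\<close> through the
    differentiated binomial sum and from \<open>R\<close> through the product rule.\<close>
  define r where "r = \<kappa> * (of_nat n * (z - cnj z) ^ (n - 1) * cnj (f z))"
  have "\<exists>b. has_wirtinger_derivatives (a' j) b 0 z" for j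
    unfolding has_wirtinger_derivatives_holomorphic [symmetric] a'_def
    by (auto intro!: exI derivative_eq_intros)
  then obtain b where b: "\<And>j. has_wirtinger_derivatives (a' j) (b j) 0 z" by metis
  have "deriv H holomorphic_on U" by (rule holomorphic_deriv[OF H U(1)])
  then have dH: "has_wirtinger_derivatives (deriv H) (deriv (deriv H) z) 0 z"
    unfolding has_wirtinger_derivatives_holomorphic [symmetric] using U by (auto intro: holomorphic_derivI)
  have "has_wirtinger_derivatives (\<lambda>w. a' j w * cnj (A j w)) (b j * cnj (A j z)) (a' j z * cnj (g j z)) z" for j
    using has_wirtinger_derivatives_mult[OF b Ac[OF U(2)], of j j] by simp
  then have "has_wirtinger_derivatives P (deriv (deriv H) z + \<kappa> * (\<Sum>j\<le>n. b j * cnj (A j z)))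
      (0 + \<kappa> * (\<Sum>j\<le>n. a' j z * cnj (g j z))) z" (is "has_wirtinger_derivatives P ?p ?r z")
    unfolding P_def[abs_def]
    by (intro has_wirtinger_derivatives_add has_wirtinger_derivatives_cmult has_wirtinger_derivatives_sum dH)
  moreover have "?r = r"
  proof -
    have "(\<Sum>j\<le>n. a' j z * cnj (g j z)) = (\<Sum>j\<le>n. of_nat (n choose j) * (of_nat j * z ^ (j - 1)) * (- cnj z) ^ (n - j)) * cnj (f z)"
      unfolding sum_distrib_right by (intro sum.cong) (simp_all add: a'_def g_def mult_ac)
    then show ?thesis unfolding binomial_derivative_sum r_def by simp
  qed
  ultimately have P1: "has_wirtinger_derivatives P ?p r z" by simp
  have R: "R w = \<kappa> * ((w - cnj w) ^ n * cnj (f w))" for w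
  proof -
    have "(\<Sum>j\<le>n. a j w * cnj (g j w)) = (\<Sum>j\<le>n. of_nat (n choose j) * w ^ j * (- cnj w) ^ (n - j)) * cnj (f w)"
      unfolding sum_distrib_right by (intro sum.cong) (simp_all add: a_def g_def mult_ac)
    then show ?thesis unfolding binomial_ring [symmetric] R_def by simp
  qed
  have id: "has_wirtinger_derivatives (\<lambda>z. z) 1 0 z"
    using has_wirtinger_derivatives_holomorphic[of "\<lambda>z. z" 1 z] by simp
  have "has_wirtinger_derivatives f (deriv f z) 0 z"
    unfolding has_wirtinger_derivatives_holomorphic [symmetric] by (rule holomorphic_derivI[OF f U])
  note fc = has_wirtinger_derivatives_cnj[OF this]
  note R1 = has_wirtinger_derivatives_cmult[of _ _ _ _ \<kappa>, OF has_wirtinger_derivatives_mult[OF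
        has_wirtinger_derivatives_power[of _ _ _ _ n, OF has_wirtinger_derivatives_diff[OF id has_wirtinger_derivatives_cnj[OF id]]] fc]]
  have "\<exists>q. has_wirtinger_derivatives R r q z"
    unfolding R[abs_def] r_def using R1 by auto
  then obtain q where "has_wirtinger_derivatives R r q z" by blast
  from hyperbolic_laplacian_wirtinger[OF U F1 P1 this]
  have L: "hyperbolic_laplacian (- int n) F z = - 4 * of_real ((Im z)\<^sup>2) * r + 2 * \<i> * of_int (- int n) * of_real (Im z) * R z" .
  \<comment> \<open>Up to a common factor, what remains is -4y^2 n (2iy)^(n-1) - 2iny (2iy)^n, which
    vanishes because (2iy)^2 = -4y^2. The weight -n is tuned to this.\<close>
  define Y where "Y = complex_of_real (Im z)"
  have zz: "z - cnj z = 2 * \<i> * Y" by (simp add: complex_diff_cnj Y_def)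
  obtain m where m: "n = Suc m" using n by (cases n) auto
  show ?thesis unfolding L R r_def zz Y_def[symmetric] of_real_power
    unfolding m by (simp add: power2_eq_square algebra_simps)
qed

text \<open>With the kernel expanded, only finite sums of products of holomorphic functions and
  conjugated ones occur, so the closure properties apply.\<close>

lemma real_analytic_on_Eichler_integral:
  fixes F H :: "complex \<Rightarrow> complex" and A :: "nat \<Rightarrow> complex \<Rightarrow> complex"
  assumes U: "open U" and H: "H holomorphic_on U" and A: "\<And>j. A j holomorphic_on U"
    and F: "\<And>w. w \<in> U \<Longrightarrow> F w = H w + \<kappa> * (\<Sum>j\<le>n. of_nat (n choose j) * w ^ j * cnj (A j w))"
  shows "real_analytic_on F U"
proof (rule real_analytic_on_cong[OF _ U])
  have "real_analytic_on (\<lambda>w. of_nat (n choose j) * w ^ j * cnj (A j w)) U" for j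
    by (intro real_analytic_on_mult real_analytic_on_cnj holomorphic_imp_real_analytic_on A U)
      (auto intro!: holomorphic_intros)
  then show "real_analytic_on (\<lambda>w. H w + \<kappa> * (\<Sum>j\<le>n. of_nat (n choose j) * w ^ j * cnj (A j w))) U"
    by (intro real_analytic_on_add real_analytic_on_mult[of "\<lambda>_. \<kappa>"] real_analytic_on_sum finite_atMost
        holomorphic_imp_real_analytic_on[OF H] holomorphic_imp_real_analytic_on[OF holomorphic_on_const] U)
qed (simp add: F)

text \<open>The function \<open>f\<close> built here is the sum of Q(w,1)^(-k), up to scaling
  Zagier's cusp form of weight 2k. Splitting each term before summing leaves pieces that are
  dominated by the weight separately.\<close>

lemma F_fun_local_Eichler_integral:
  assumes k: "k > 1" and D: "D > 0" and nsq: "\<not> (\<exists>n::int. D = n\<^sup>2)" and z0: "Im z0 > 0" and E: "z0 \<notin> exceptional_set D"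
  obtains U H f A \<kappa> where "open U" "z0 \<in> U" "U \<subseteq> upper_half_plane" "H holomorphic_on U" "f holomorphic_on U"
    "\<And>j w. w \<in> U \<Longrightarrow> (A j has_field_derivative (- w) ^ (2 * k - 2 - j) * f w) (at w)"
    "\<And>w. w \<in> U \<Longrightarrow> F_fun k D w = H w + \<kappa> * (\<Sum>j\<le>2 * k - 2. of_nat ((2 * k - 2) choose j) * w ^ j * cnj (A j w))"
proof -
  obtain r where r: "0 < r" "r \<le> Im z0 / 2" and const:
    "\<And>Q w. Q \<in> qforms D \<Longrightarrow> w \<in> ball z0 r \<Longrightarrow> qform_circle Q w \<noteq> 0 \<and> sgn (qform_circle Q w) = sgn (qform_circle Q z0)"
    using sgn_qform_circle_locally_constant[OF D nsq z0 E] by blast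
  define U where "U = ball z0 r"
  have U: "open U" "convex U" "z0 \<in> U" using r by (auto simp: U_def)
  define n where "n = 2 * k - 2"
  define X Y B where "X = \<bar>Re z0\<bar> + r" and "Y = Im z0 + r" and "B = cmod z0 + r"
  have strip: "r \<le> Im w" "Im w \<le> Y" "\<bar>Re w\<bar> \<le> X" "cmod w \<le> B" if "w \<in> U" for w
  proof -
    have "w \<in> cball z0 r" using that by (auto simp: U_def)
    from ball_in_strip[OF this] r show "r \<le> Im w" "Im w \<le> Y" "\<bar>Re w\<bar> \<le> X" by (auto simp: X_def Y_def)
    show "cmod w \<le> B" using that norm_triangle_sub[of w z0] by (auto simp: U_def B_def dist_norm norm_minus_commute)
  qed
  have Im_pos: "Im w > 0" if "w \<in> U" for w using strip(1)[OF that] r by simp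
  have B: "B \<ge> 0" using r by (simp add: B_def)
  define h where "h Q w = inverse (qform_eval Q w 1 ^ k)" for Q w
  define K where "K = qform_const D r X ^ k"
  have h_le: "cmod (h Q w) \<le> K * qform_weight Q" if "Q \<in> qforms D" "w \<in> U" for Q w
    unfolding h_def K_def norm_inverse norm_power
    using inverse_norm_qform_eval_power_le[OF that(1) D r(1) strip(1,3)[OF that(2)]] k by simp
  have h_hol: "h Q holomorphic_on U" if "Q \<in> qforms D" for Q
    unfolding h_def using norm_qform_eval_ge(4)[OF that D Im_pos]
    by (cases Q) (auto intro!: holomorphic_intros)
  define f where "f w = (\<Sum>\<^sub>\<infinity>Q\<in>qforms D. h Q w)" for w
  note weight = qform_weight_summable[OF nsq]
  have f: "f holomorphic_on U"
    unfolding holomorphic_on_open[OF U(1)]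
  proof (intro ballI exI)
    fix w assume "w \<in> U"
    show "(f has_field_derivative (\<Sum>\<^sub>\<infinity>Q\<in>qforms D. deriv (h Q) w)) (at w)"
      unfolding f_def
      by (rule has_field_derivative_infsum[OF U(1) \<open>w \<in> U\<close> _ h_le summable_on_cmult_right[OF weight]])
        (rule holomorphic_derivI[OF h_hol U(1)])
  qed
  \<comment> \<open>Normalising the primitives to vanish at \<open>z0\<close> removes the free
    constants, which could otherwise destroy summability over the forms.\<close>
  have "\<exists>a. (\<forall>w\<in>U. (a has_field_derivative (- w) ^ (n - j) * h Q w) (at w)) \<and> a z0 = 0"
    if Q: "Q \<in> qforms D" for Q j
  proof -
    have "(\<lambda>w. (- w) ^ (n - j) * h Q w) holomorphic_on U" by (intro holomorphic_intros h_hol Q)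
    from holomorphic_convex_primitive'[OF U(2,1) this]
    obtain a where "\<And>w. w \<in> U \<Longrightarrow> (a has_field_derivative (- w) ^ (n - j) * h Q w) (at w within U)" by blast
    then have "(a has_field_derivative (- w) ^ (n - j) * h Q w) (at w)" if "w \<in> U" for w
      using at_within_open[OF that U(1)] that by metis
    then have "\<forall>w\<in>U. ((\<lambda>w. a w - a z0) has_field_derivative (- w) ^ (n - j) * h Q w) (at w)"
      using DERIV_diff[OF _ DERIV_const] by fastforce
    then show ?thesis by (intro exI[of _ "\<lambda>w. a w - a z0"]) simp
  qed
  then have "\<exists>a. \<forall>Q j. Q \<in> qforms D \<longrightarrow> (\<forall>w\<in>U. (a Q j has_field_derivative (- w) ^ (n - j) * h Q w) (at w)) \<and> a Q j z0 = 0"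
    by metis
  then obtain a where a: "\<And>Q j w. Q \<in> qforms D \<Longrightarrow> w \<in> U \<Longrightarrow> (a Q j has_field_derivative (- w) ^ (n - j) * h Q w) (at w)"
    and a0: "\<And>Q j. Q \<in> qforms D \<Longrightarrow> a Q j z0 = 0" by blast
  \<comment> \<open>Mean value estimate on the ball: |w|^(n-j) <= B^(n-j), the bound
    \<open>K\<close> for the inverse power of the form, and distance at most \<open>r\<close> from
    \<open>z0\<close>.\<close>
  define M where "M j = B ^ (n - j) * K * r" for j
  have a_le: "cmod (a Q j w) \<le> M j * qform_weight Q" if Q: "Q \<in> qforms D" and w: "w \<in> U" for Q j w
  proof -
    have "cmod (a Q j w - a Q j z0) \<le> (B ^ (n - j) * (K * qform_weight Q)) * cmod (w - z0)"
    proof (rule field_differentiable_bound[OF U(2)])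
      fix x assume x: "x \<in> U"
      show "(a Q j has_field_derivative (- x) ^ (n - j) * h Q x) (at x within U)"
        using a[OF Q x] by (rule has_field_derivative_at_within)
      show "cmod ((- x) ^ (n - j) * h Q x) \<le> B ^ (n - j) * (K * qform_weight Q)"
        unfolding norm_mult norm_power norm_minus_cancel
        using strip(4)[OF x] B by (intro mult_mono power_mono h_le Q x) auto
    qed (use w U in auto)
    also have "\<dots> \<le> (B ^ (n - j) * (K * qform_weight Q)) * r"
      using w B order_trans[OF norm_ge_zero h_le[OF Q w]] by (intro mult_left_mono) (auto simp: U_def dist_norm norm_minus_commute)
    finally show ?thesis by (simp add: a0[OF Q] M_def mult_ac)
  qed
  define A where "A j w = (\<Sum>\<^sub>\<infinity>Q\<in>qforms D. a Q j w)" for j w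
  have A: "(A j has_field_derivative (- w) ^ (n - j) * f w) (at w)" if w: "w \<in> U" for j w
    using has_field_derivative_infsum[where g = "\<lambda>Q. a Q j", OF U(1) w a a_le summable_on_cmult_right[OF weight]]
    by (simp add: A_def[abs_def] f_def infsum_cmult_right')
  have A_sum: "((\<lambda>Q. a Q j w) has_sum A j w) (qforms D)" if "w \<in> U" for j w
    unfolding A_def
    by (rule has_sum_infsum[OF abs_summable_summable[OF Infinite_Sum.abs_summable_on_comparison_test'[OF
        summable_on_cmult_right[OF weight] a_le[OF _ that]]]])
  \<comment> \<open>The last factor compensates (w - cnj(w))^n = (2i Im w)^n, so that the
    antiholomorphic derivative of the Eichler part equals that of the summand.\<close>
  define C where "C = \<i> / 2 * of_real (sqrt (of_int D) ^ (2 * k - 1)) * (1 / (2 * \<i>)) ^ n"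
  define b where "b j w = of_nat (n choose j) * w ^ j" for j and w :: complex
  define H where "H Q w = F_summand k D w Q - C * (\<Sum>j\<le>n. b j w * cnj (a Q j w))" for Q w
  have H_der: "\<exists>p. (H Q has_field_derivative p) (at w)" if Q: "Q \<in> qforms D" and w: "w \<in> U" for Q w
  proof -
    have nz: "qform_circle Q z0 \<noteq> 0" using const[OF Q, of z0] r by auto
    obtain p where p: "has_wirtinger_derivatives (\<lambda>z. F_summand k D z Q) p
      (\<i> / 2 * of_real (sqrt (of_int D) ^ (2 * k - 1)) * of_real (Im w) ^ (2 * k - 2) * cnj (inverse (qform_eval Q w 1 ^ k))) w"
      using F_summand_wirtinger[OF k Q D U(1) w Im_pos _ nz] const[OF Q] by (auto simp: U_def)
    have "\<exists>b'. has_wirtinger_derivatives (b j) b' 0 w" for j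
      unfolding has_wirtinger_derivatives_holomorphic [symmetric] b_def
      by (auto intro!: exI derivative_eq_intros)
    then obtain b' where b': "\<And>j. has_wirtinger_derivatives (b j) (b' j) 0 w" by metis
    note ac = has_wirtinger_derivatives_cnj[OF a[OF Q w, unfolded has_wirtinger_derivatives_holomorphic]]
    have "has_wirtinger_derivatives (H Q) (p - C * (\<Sum>j\<le>n. b' j * cnj (a Q j w) + b j w * cnj 0))
      (\<i> / 2 * of_real (sqrt (of_int D) ^ (2 * k - 1)) * of_real (Im w) ^ (2 * k - 2) * cnj (inverse (qform_eval Q w 1 ^ k))
       - C * (\<Sum>j\<le>n. 0 * cnj (a Q j w) + b j w * cnj ((- w) ^ (n - j) * h Q w))) w" (is "has_wirtinger_derivatives _ ?p ?q _")
      unfolding H_def[abs_def]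
      by (intro has_wirtinger_derivatives_diff has_wirtinger_derivatives_cmult has_wirtinger_derivatives_sum
          has_wirtinger_derivatives_mult p b' ac)
    moreover have "?q = 0"
    proof -
      have "(\<Sum>j\<le>n. 0 * cnj (a Q j w) + b j w * cnj ((- w) ^ (n - j) * h Q w))
        = (\<Sum>j\<le>n. of_nat (n choose j) * w ^ j * (- cnj w) ^ (n - j)) * cnj (h Q w)"
        unfolding sum_distrib_right by (intro sum.cong) (simp_all add: b_def mult_ac)
      also have "\<dots> = (w - cnj w) ^ n * cnj (h Q w)" unfolding binomial_ring [symmetric] by simp
      also have "w - cnj w = 2 * \<i> * of_real (Im w)" by (simp add: complex_diff_cnj)
      finally have S: "(\<Sum>j\<le>n. 0 * cnj (a Q j w) + b j w * cnj ((- w) ^ (n - j) * h Q w))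
        = (2 * \<i> * of_real (Im w)) ^ n * cnj (h Q w)" .
      have "(1 / (2 * \<i>)) ^ n * (2 * \<i> * of_real (Im w)) ^ n = complex_of_real (Im w) ^ n"
        unfolding power_mult_distrib [symmetric] by simp
      then have "C * ((2 * \<i> * of_real (Im w)) ^ n * cnj (h Q w))
        = \<i> / 2 * of_real (sqrt (of_int D) ^ (2 * k - 1)) * of_real (Im w) ^ n * cnj (h Q w)"
        unfolding C_def by (metis mult.assoc)
      then show ?thesis unfolding S unfolding h_def n_def[symmetric] by (simp only: diff_self)
    qed
    ultimately show ?thesis by (auto simp: has_wirtinger_derivatives_holomorphic)
  qed
  \<comment> \<open>The first summand bounds the original term, the second its Eichler polynomial;
    both are measured against the same weight.\<close>
  define L where "L = (of_int D * Y\<^sup>2) powr (real k - 1/2) * qform_const D r X ^ k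
      + cmod C * (\<Sum>j\<le>n. real (n choose j) * B ^ j * M j)"
  have H_le: "cmod (H Q w) \<le> L * qform_weight Q" if Q: "Q \<in> qforms D" and w: "w \<in> U" for Q w
  proof -
    have "cmod (\<Sum>j\<le>n. b j w * cnj (a Q j w)) \<le> (\<Sum>j\<le>n. real (n choose j) * B ^ j * (M j * qform_weight Q))"
      using strip(4)[OF w] B unfolding b_def norm_mult norm_power norm_of_nat complex_mod_cnj
      by (intro sum_norm_le) (auto simp: norm_mult norm_power intro!: mult_mono power_mono a_le Q w)
    also have "\<dots> = (\<Sum>j\<le>n. real (n choose j) * B ^ j * M j) * qform_weight Q"
      unfolding sum_distrib_right by (intro sum.cong) simp_all
    finally have "cmod (C * (\<Sum>j\<le>n. b j w * cnj (a Q j w))) \<le> cmod C * ((\<Sum>j\<le>n. real (n choose j) * B ^ j * M j) * qform_weight Q)"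
      unfolding norm_mult by (rule mult_left_mono) simp
    moreover have "cmod (F_summand k D w Q) \<le> (of_int D * Y\<^sup>2) powr (real k - 1/2) * qform_const D r X ^ k * qform_weight Q"
      by (rule norm_F_summand_le_weight[OF k Q D r(1) strip(1,3,2)[OF w]])
    ultimately show ?thesis
      unfolding H_def L_def using norm_triangle_ineq4[of "F_summand k D w Q" "C * (\<Sum>j\<le>n. b j w * cnj (a Q j w))"]
      by (simp add: algebra_simps)
  qed
  define H' where "H' w = (\<Sum>\<^sub>\<infinity>Q\<in>qforms D. H Q w)" for w
  have H'_hol: "H' holomorphic_on U"
    unfolding holomorphic_on_open[OF U(1)]
  proof (intro ballI exI)
    fix w assume "w \<in> U"
    show "(H' has_field_derivative (\<Sum>\<^sub>\<infinity>Q\<in>qforms D. deriv (H Q) w)) (at w)"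
      unfolding H'_def
      by (rule has_field_derivative_infsum[OF U(1) \<open>w \<in> U\<close> _ H_le summable_on_cmult_right[OF weight]])
        (use H_der DERIV_imp_deriv in metis)
  qed
  have H_sum: "((\<lambda>Q. H Q w) has_sum H' w) (qforms D)" if "w \<in> U" for w
    unfolding H'_def
    by (rule has_sum_infsum[OF abs_summable_summable[OF Infinite_Sum.abs_summable_on_comparison_test'[OF
        summable_on_cmult_right[OF weight] H_le[OF _ that]]]])
  define c where "c = complex_of_real (of_int D powr (1/2 - real k) / (real ((2 * k - 2) choose (k - 1)) * pi))"
  have F: "F_fun k D w = c * H' w + (c * C) * (\<Sum>j\<le>n. of_nat (n choose j) * w ^ j * cnj (A j w))" if w: "w \<in> U" for w
  proof -
    have "((\<lambda>Q. cnj (a Q j w)) has_sum cnj (A j w)) (qforms D)" for j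
      using A_sum[OF w, of j] by simp
    then have "((\<lambda>Q. H Q w + C * (\<Sum>j\<le>n. b j w * cnj (a Q j w))) has_sum
        (H' w + C * (\<Sum>j\<le>n. b j w * cnj (A j w)))) (qforms D)"
      by (intro has_sum_add H_sum w has_sum_cmult_right has_sum_finite_sum)
    then have "((\<lambda>Q. F_summand k D w Q) has_sum (H' w + C * (\<Sum>j\<le>n. b j w * cnj (A j w)))) (qforms D)"
      by (simp add: H_def)
    then have "(\<Sum>\<^sub>\<infinity>Q\<in>qforms D. F_summand k D w Q) = H' w + C * (\<Sum>j\<le>n. b j w * cnj (A j w))" by (rule infsumI)
    then show ?thesis unfolding F_fun_def c_def[symmetric] by (simp add: b_def algebra_simps)
  qed
  show ?thesis
  proof (rule that)
    show "(\<lambda>w. c * H' w) holomorphic_on U" by (intro holomorphic_intros H'_hol)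
    show "U \<subseteq> upper_half_plane" using Im_pos by (auto simp: upper_half_plane_def)
    show "(A j has_field_derivative (- w) ^ (2 * k - 2 - j) * f w) (at w)" if "w \<in> U" for j w
      using A[OF that] by (simp add: n_def)
    show "F_fun k D w = c * H' w + (c * C) * (\<Sum>j\<le>2 * k - 2. of_nat ((2 * k - 2) choose j) * w ^ j * cnj (A j w))"
      if "w \<in> U" for w using F[OF that] by (simp add: n_def)
  qed (use U f in auto)
qed

theorem theorem1p1:
  fixes k :: nat and D :: int
  assumes "k > 1" and "D > 0" and "discriminant D" and "\<not> (\<exists>n::int. D = n\<^sup>2)"
  shows "(\<forall>\<tau>\<in>upper_half_plane. F_summand k D \<tau> summable_on qforms D) \<and>
    locally_harmonic_maass_form (2 - 2 * int k) (exceptional_set D) (F_fun k D)"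
  unfolding locally_harmonic_maass_form_def
proof (intro conjI ballI)
  note hyps = assms(1,2,4)
  fix \<tau> assume "\<tau> \<in> upper_half_plane"
  then show "F_summand k D \<tau> summable_on qforms D"
    by (intro F_summand_summable hyps) (simp add: upper_half_plane_def)
next
  fix \<gamma> \<tau> assume "\<gamma> \<in> SL2Z" "\<tau> \<in> upper_half_plane"
  then show "slash (F_fun k D) (2 - 2 * int k) \<gamma> \<tau> = F_fun k D \<tau>"
    using assms(1) by (rule slash_F_fun)
next
  note hyps = assms(1,2,4)
  fix \<tau> assume "\<tau> \<in> upper_half_plane - exceptional_set D"
  then have \<tau>: "Im \<tau> > 0" "\<tau> \<notin> exceptional_set D" by (auto simp: upper_half_plane_def)
  obtain U H f A \<kappa>
    where U: "open U" "\<tau> \<in> U" "U \<subseteq> upper_half_plane" and H: "H holomorphic_on U" and f: "f holomorphic_on U"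
    and A: "\<And>j w. w \<in> U \<Longrightarrow> (A j has_field_derivative (- w) ^ (2 * k - 2 - j) * f w) (at w)"
    and F: "\<And>w. w \<in> U \<Longrightarrow> F_fun k D w = H w + \<kappa> * (\<Sum>j\<le>2 * k - 2. of_nat ((2 * k - 2) choose j) * w ^ j * cnj (A j w))"
    by (rule F_fun_local_Eichler_integral[OF hyps \<tau>], rule that)
  have A_hol: "A j holomorphic_on U" for j using A by (auto simp: holomorphic_on_open[OF U(1)])
  have w: "2 - 2 * int k = - int (2 * k - 2)" using assms(1) by simp
  show "\<exists>U. open U \<and> \<tau> \<in> U \<and> U \<subseteq> upper_half_plane \<and> real_analytic_on (F_fun k D) U \<and>
      (\<forall>z\<in>U. hyperbolic_laplacian (2 - 2 * int k) (F_fun k D) z = 0)"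
  proof (intro exI[of _ U] conjI ballI U)
    show "real_analytic_on (F_fun k D) U" by (rule real_analytic_on_Eichler_integral[OF U(1) H A_hol F])
    show "hyperbolic_laplacian (2 - 2 * int k) (F_fun k D) z = 0" if "z \<in> U" for z
      unfolding w by (rule hyperbolic_laplacian_Eichler_integral[OF U(1) that _ H f A F]) (use assms(1) in auto)
  qed
next
  note hyps = assms(1,2,4)
  fix \<tau> assume "\<tau> \<in> exceptional_set D"
  then have "Im \<tau> > 0" by (auto simp: exceptional_set_def geodesic_def upper_half_plane_def)
  from F_fun_vertical_limit[OF hyps this]
  show "\<exists>L. ((\<lambda>h::real. F_fun k D (\<tau> + \<i> * of_real h) + F_fun k D (\<tau> - \<i> * of_real h)) \<longlongrightarrow> L) (at_right 0) \<and>
        F_fun k D \<tau> = 1/2 * L" by (intro exI[of _ "2 * F_fun k D \<tau>"]) simp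
next
  from F_fun_growth[OF assms(1,2,4)] obtain C where
    "\<forall>z. Im z \<ge> 1 \<longrightarrow> cmod (F_fun k D z) \<le> C * Im z ^ (2 * k - 1)" by blast
  then show "\<exists>(N::nat) C Y. Y > 0 \<and> (\<forall>\<tau>. Im \<tau> \<ge> Y \<longrightarrow> cmod (F_fun k D \<tau>) \<le> C * Im \<tau> ^ N)"
    by (intro exI[of _ "2 * k - 1"] exI[of _ C] exI[of _ 1]) auto
qed

end
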